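(* Let a classical affine field theory on a spacetime system be given (data satisfying (C1)--(C7) of the context). Suppose that all regions and hypersurfaces of the spacetime system arise as submanifolds of a fixed manifold $B$ (possibly with additional structure) of dimension $d$. Let $\{\varphi_\Sigma\}$ be a global solution, i.e. an assignment of an element $\varphi_\Sigma\in A_\Sigma$ to every hypersurface $\Sigma$ such that: $\varphi_{\overline\Sigma}=\varphi_\Sigma$ for every hypersurface $\Sigma$; $\varphi_\Sigma=(\varphi_{\Sigma_1},\dots,\varphi_{\Sigma_n})$ for every disjoint union of hypersurfaces $\Sigma=\Sigma_1\cup\dots\cup\Sigma_n$; and $\varphi_{\partial M}\in A_{\tilde M}$ for every region $M$. (V1) For every hypersurface $\Sigma$ take as distinguished state (vacuum state) the affine coherent state $\psi_{\Sigma,0}:=\hat K_{\Sigma,\varphi_\Sigma}\in\mathcal{H}_\Sigma$. Then: (V2) $\psi_{\overline\Sigma,0}=\iota_\Sigma(\psi_{\Sigma,0})$ for every hypersurface $\Sigma$; (V3) $\psi_{\Sigma,0}=\psi_{\Sigma_1,0}\otimes\cdots\otimes\psi_{\Sigma_n,0}$ for every disjoint union $\Sigma=\Sigma_1\cup\dots\cup\Sigma_n$; and, for every region $M$, $\rho_M(\psi_{\partial M,0})=\exp(\mathrm{i}S_M(\varphi_{\partial M}))$. Hence the property (V5) [$\rho_M(\psi_{\partial M,0})=1$ for every region $M$] is generically not satisfied, but (V5') $|\rho_M(\psi_{\partial M,0})|=1$ holds for every region $M$. Moreover, if for every region $M$ the action $S_M$ is replaced by $\tilde S_M(\zeta):=S_M(\zeta)-S_M(\varphi_{\partial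 M})$, then axioms (C1)--(C7) are equally satisfied with the actions $\tilde S_M$; the integrability condition for gluings (defined in the context) remains unaffected by this replacement; and with the amplitude maps defined using the actions $\tilde S_M$ the states $\psi_{\Sigma,0}$ satisfy (V1), (V2), (V3) and also (V5): $\rho_M(\psi_{\partial M,0})=1$ for every region $M$.
   Context: Spacetime system. Fix a positive integer $d$. A spacetime system is a collection of oriented topological $d$-manifolds, possibly with boundary (regions), and a collection of oriented topological $(d-1)$-manifolds without boundary (hypersurfaces), all with finitely many components, called admissible, closed under taking connected components and finite disjoint unions, with boundaries of regions being hypersurfaces, and with $\overline\Sigma$ ($\Sigma$ with opposite orientation) a hypersurface whenever $\Sigma$ is. In addition, for each hypersurface $\Sigma$ (forgetting orientation) there is an empty region $\hat\Sigma$, topologically the hypersurface itself, thought of as an infinitesimally thin region, with boundary the disjoint union $\partial\hat\Sigma=\Sigma\cup\overline\Sigma$; empty regions count as regions. Gluing: if $\partial M=\Sigma_1\cup\Sigma\cup\overline{\Sigma'}$ is a disjoint union with $\Sigma'$ a copy of $\Sigma$, $M_1$ is obtained by identifying corresponding points of $\Sigma$ and $\Sigma'$; the gluing is admissible if $M_1$ is a region; then $\partial M_1=\Sigma_1$. When all regions and hypersurfaces are submanifolds of one manifold $B$, a hypersurface and its copy $\Sigma'$ are understood as the same submanifold of $B$, so that a global solution has $\varphi_{\Sigma'}=\varphi_\Sigma$. Classical affine field theory. (C1) To each hypersurface $\Sigma$: a complex separable Hilbert space $L_\Sigma$ with inner product $\{\cdot,\cdot\}_\Sigma$ (conjugate linear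 in the first, linear in the second argument) and an affine space $A_\Sigma$ over $L_\Sigma$ (free transitive abelian action, written $+$) with induced topology. $g_\Sigma:=\Re\{\cdot,\cdot\}_\Sigma$, $\omega_\Sigma:=\frac12\Im\{\cdot,\cdot\}_\Sigma$. There are continuous maps $\theta_\Sigma:A_\Sigma\times L_\Sigma\to\mathbb{R}$, real linear in the second argument, and $[\cdot,\cdot]_\Sigma:L_\Sigma\times L_\Sigma\to\mathbb{R}$, real bilinear, with $[\phi,\phi']_\Sigma+\theta_\Sigma(\eta,\phi')=\theta_\Sigma(\phi+\eta,\phi')$ and $\omega_\Sigma(\phi,\phi')=\frac12[\phi,\phi']_\Sigma-\frac12[\phi',\phi]_\Sigma$ for all $\eta\in A_\Sigma$, $\phi,\phi'\in L_\Sigma$. (C2) $A_{\overline\Sigma}$ is identified with $A_\Sigma$ (homeomorphic involution) and $L_{\overline\Sigma}$ with $L_\Sigma$ (compatible conjugate linear involution), with $\{\phi',\phi\}_{\overline\Sigma}=\overline{\{\phi',\phi\}_\Sigma}$, $\theta_{\overline\Sigma}=-\theta_\Sigma$, $[\cdot,\cdot]_{\overline\Sigma}=-[\cdot,\cdot]_\Sigma$. (C3) For a disjoint union $\Sigma=\Sigma_1\cup\dots\cup\Sigma_n$: $A_\Sigma=A_{\Sigma_1}\times\dots\times A_{\Sigma_n}$ (homeomorphically) and $L_\Sigma=L_{\Sigma_1}\oplus\dots\oplus L_{\Sigma_n}$ (isometrically, compatibly), associatively; $\theta_\Sigma$ and $[\cdot,\cdot]_\Sigma$ are the sums of the $\theta_{\Sigma_i}$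 and $[\cdot,\cdot]_{\Sigma_i}$. (C4) To each region $M$: a real vector space $L_M$, an affine space $A_M$ over $L_M$, a map $S_M:A_M\to\mathbb{R}$ (the action). (C5) To each region $M$: a map $a_M:A_M\to A_{\partial M}$ and a compatible real linear map $r_M:L_M\to L_{\partial M}$, with images $A_{\tilde M}$, $L_{\tilde M}$. $L_{\tilde M}$ is a closed Lagrangian subspace of the real Hilbert space $L_{\partial M}$ with respect to $\omega_{\partial M}$. $S_M(\eta)=S_M(\eta')$ if $a_M(\eta)=a_M(\eta')$ (so $S_M$ may be regarded as a function on $A_{\tilde M}$), and $S_M(\eta)=S_M(\eta')-\frac12\theta_{\partial M}(\eta,\eta-\eta')-\frac12\theta_{\partial M}(\eta',\eta-\eta')$ for all $\eta,\eta'\in A_M$ (the maps $a_M,r_M$ omitted from notation). (C6) For a disjoint union $M=M_1\cup M_2$ of regions: $A_M=A_{M_1}\times A_{M_2}$, $L_M=L_{M_1}\oplus L_{M_2}$ (compatibly, associatively), $a_M=a_{M_1}\times a_{M_2}$, $r_M=r_{M_1}\times r_{M_2}$, $S_M=S_{M_1}+S_{M_2}$. (C7) For an admissible gluing of $M$ to $M_1$ along $\Sigma,\overline{\Sigma'}$: there are an injective map $a_{M;\Sigma,\overline{\Sigma'}}:A_{M_1}\hookrightarrow A_M$ and a compatible injective linear map $r_{M;\Sigma,\overline{\Sigma'}}:L_{M_1}\hookrightarrow L_M$ whose images are exactly the elements whose two projections to $A_\Sigma$ (resp. $L_\Sigma$), via $\Sigma$ and via $\overline{\Sigma'}$, coincide;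 $S_{M_1}=S_M\circ a_{M;\Sigma,\overline{\Sigma'}}$; and $a_{M_1}$ (resp. $r_{M_1}$) equals the composition of $a_{M;\Sigma,\overline{\Sigma'}}$, $a_M$ (resp. $r_{M;\Sigma,\overline{\Sigma'}}$, $r_M$) and the projection to $A_{\partial M_1}$ (resp. $L_{\partial M_1}$). Measures. For a Hilbert space $L$, $\hat L$ is the algebraic dual of the topological dual of $L$, so $L\subseteq\hat L$ naturally. $\nu_\Sigma$ is the centred Gaussian probability measure on $\hat L_\Sigma$ with $\int e^{\mathrm{i}g_\Sigma(\xi,\phi)}\,\mathrm{d}\nu_\Sigma(\phi)=e^{-\frac12 g_\Sigma(\xi,\xi)}$ for $\xi\in L_\Sigma$ (heuristic density $e^{-\frac12g_\Sigma(\phi,\phi)}$). $\nu_{\tilde M}$ is the centred Gaussian probability measure on $\hat L_{\tilde M}\subseteq\hat L_{\partial M}$ with $\int e^{\mathrm{i}g_{\partial M}(\xi,\phi)}\,\mathrm{d}\nu_{\tilde M}(\phi)=e^{-g_{\partial M}(\xi,\xi)}$ for $\xi\in L_{\tilde M}$. States. For $\eta\in A_\Sigma$ set $\alpha_\Sigma^\eta(\varphi):=\exp(\frac{\mathrm{i}}2\theta_\Sigma(\eta,\varphi-\eta)+\frac{\mathrm{i}}2\theta_\Sigma(\varphi,\varphi-\eta)-\frac14g_\Sigma(\varphi-\eta,\varphi-\eta))$. The state space $\mathcal{H}_\Sigma$ consists of the functions $\psi$ on $A_\Sigma$ of the form $\psi(\varphi)=\chi^\eta(\varphi-\eta)\alpha_\Sigma^\eta(\varphi)$,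 where $\chi^\eta$ is the restriction to $L_\Sigma$ of a (uniquely determined) $\nu_\Sigma$-square-integrable holomorphic function on $\hat L_\Sigma$, also denoted $\chi^\eta$; the inner product is $\langle\psi',\psi\rangle_\Sigma=\int_{\hat L_\Sigma}\chi^\eta\,\overline{\chi'^\eta}\,\mathrm{d}\nu_\Sigma$. This does not depend on the base point $\eta$. $\iota_\Sigma:\mathcal{H}_\Sigma\to\mathcal{H}_{\overline\Sigma}$ is complex conjugation of functions; for disjoint unions, $\mathcal{H}_{\Sigma_1\cup\Sigma_2}$ is the completed tensor product of $\mathcal{H}_{\Sigma_1}$ and $\mathcal{H}_{\Sigma_2}$, with $\psi_1\otimes\psi_2$ the product function on $A_{\Sigma_1}\times A_{\Sigma_2}$. The affine coherent state of $\zeta\in A_\Sigma$ is $\hat K_{\Sigma,\zeta}(\varphi):=\exp(\frac{\mathrm{i}}2\theta_\Sigma(\zeta,\varphi-\zeta)+\frac{\mathrm{i}}2\theta_\Sigma(\varphi,\varphi-\zeta)-\frac14g_\Sigma(\varphi-\zeta,\varphi-\zeta))$, an element of $\mathcal{H}_\Sigma$. Amplitudes. For any $\eta\in A_M$ (also denoting its image in $A_{\partial M}$), and $\psi\in\mathcal{H}_{\partial M}$ decomposed with base point $\eta$, $\rho_M(\psi):=\exp(\mathrm{i}S_M(\eta))\int_{\hat L_{\tilde M}}\chi^\eta(\phi)\,\mathrm{d}\nu_{\tilde M}(\phi)$ whenever $\chi^\eta$ is $\nu_{\tilde M}$-integrable on $\hat L_{\tilde M}$; this does not depend on $\eta$.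 Integrability condition. For an admissible gluing of $M$ to $M_1$ along $\Sigma,\overline{\Sigma'}$ with $\partial M=\Sigma_1\cup\Sigma\cup\overline{\Sigma'}$, and $\eta\in A_{M_1}$, let $\eta_0\in A_\Sigma$ be the element induced by $\eta$, i.e. the common projection to $A_\Sigma$ of $a_M(a_{M;\Sigma,\overline{\Sigma'}}(\eta))$. The gluing data satisfy the integrability condition if for some, hence any, $\eta\in A_{M_1}$ the extension to $\hat L_\Sigma$ of the function $\Phi:L_\Sigma\to\mathbb{C}$, $\Phi(\xi):=\rho_M(\hat K_{\Sigma_1,\eta}\otimes\hat K_{\Sigma,\eta_0+\xi}\otimes\iota_\Sigma(\hat K_{\Sigma,\eta_0+\xi}))\exp(\frac12g_\Sigma(\xi,\xi))$, is $\nu_\Sigma$-integrable with integral different from zero (in $\hat K_{\Sigma_1,\eta}$, $\eta$ stands for $a_{M_1}(\eta)\in A_{\Sigma_1}$). *)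

theory Defs
  imports "HOL-Probability.Probability" "HOL-Homology.Homology"
begin

section \<open>Oriented topological manifolds\<close>

text \<open>Orientations are given by local homology classes: an orientation picks, locally consistently,
  a generator of \<open>H\<^sub>n(X, X - {x})\<close> at every point.  This also covers \<open>n = 0\<close> (signed points).\<close>

definition manifold_dim :: "nat \<Rightarrow> 'x topology \<Rightarrow> bool" where
  "manifold_dim n X \<longleftrightarrow> Hausdorff_space X \<and> second_countable X \<and>
     (\<forall>x\<in>topspace X. \<exists>U. openin X U \<and> x \<in> U \<and>
        subtopology X U homeomorphic_space Euclidean_space n)"

definition half_space :: "nat \<Rightarrow> (nat \<Rightarrow> real) topology" where
  "half_space n = subtopology (Euclidean_space n) {v. 0 \<le> v 0}"

definition bordered_manifold_dim :: "nat \<Rightarrow> 'x topology \<Rightarrow> bool" where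
  "bordered_manifold_dim n X \<longleftrightarrow> Hausdorff_space X \<and> second_countable X \<and>
     (\<forall>x\<in>topspace X. \<exists>U. openin X U \<and> x \<in> U \<and>
        (subtopology X U homeomorphic_space Euclidean_space n \<or>
         subtopology X U homeomorphic_space half_space n))"

definition interior_points :: "nat \<Rightarrow> 'x topology \<Rightarrow> 'x set" where
  "interior_points n X = {x \<in> topspace X. \<exists>U. openin X U \<and> x \<in> U \<and>
     subtopology X U homeomorphic_space Euclidean_space n}"

definition local_homology :: "int \<Rightarrow> 'x topology \<Rightarrow> 'x \<Rightarrow> 'x chain set monoid" where
  "local_homology n X x = relative_homology_group n X (topspace X - {x})"

definition local_push ::
    "int \<Rightarrow> 'x topology \<Rightarrow> 'y topology \<Rightarrow> ('x \<Rightarrow> 'y) \<Rightarrow> 'x \<Rightarrow> 'x chain set \<Rightarrow> 'y chain set" where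
  "local_push n X Y f x = hom_induced n X (topspace X - {x}) Y (topspace Y - {f x}) f"

definition orientation_on ::
    "int \<Rightarrow> 'x topology \<Rightarrow> 'x set \<Rightarrow> ('x \<Rightarrow> 'x chain set) \<Rightarrow> bool" where
  "orientation_on n X W ori \<longleftrightarrow> ori \<in> extensional W \<and>
     (\<forall>x\<in>W. ori x \<in> carrier (local_homology n X x) \<and>
        carrier (local_homology n X x) = generate (local_homology n X x) {ori x}) \<and>
     (\<forall>x\<in>W. \<exists>U. openin X U \<and> x \<in> U \<and> U \<subseteq> W \<and>
        (\<exists>c \<in> carrier (relative_homology_group n X (topspace X - U)).
           \<forall>y\<in>U. hom_induced n X (topspace X - U) X (topspace X - {y}) id c = ori y))"


section \<open>Hypersurfaces and regions\<close>

record 'p hyp =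
  htop :: "'p topology"
  hori :: "'p \<Rightarrow> 'p chain set"

abbreviation hpts :: "'p hyp \<Rightarrow> 'p set" where
  "hpts S \<equiv> topspace (htop S)"

definition hypersurface :: "nat \<Rightarrow> 'p hyp \<Rightarrow> bool" where
  "hypersurface d S \<longleftrightarrow> manifold_dim (d - 1) (htop S) \<and>
     finite (connected_components_of (htop S)) \<and>
     orientation_on (int d - 1) (htop S) (hpts S) (hori S)"

definition rev_hyp :: "nat \<Rightarrow> 'p hyp \<Rightarrow> 'p hyp" where
  "rev_hyp d S = \<lparr>htop = htop S,
     hori = (\<lambda>x\<in>hpts S. inv\<^bsub>local_homology (int d - 1) (htop S) x\<^esub> (hori S x))\<rparr>"

definition oriented_map :: "nat \<Rightarrow> 'p hyp \<Rightarrow> 'p hyp \<Rightarrow> ('p \<Rightarrow> 'p) \<Rightarrow> bool" where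
  "oriented_map d S S' f \<longleftrightarrow>
     (\<forall>x\<in>hpts S. local_push (int d - 1) (htop S) (htop S') f x (hori S x) = hori S' (f x))"

definition oriented_open_embedding :: "nat \<Rightarrow> 'p hyp \<Rightarrow> 'p hyp \<Rightarrow> ('p \<Rightarrow> 'p) \<Rightarrow> bool" where
  "oriented_open_embedding d S S' f \<longleftrightarrow> embedding_map (htop S) (htop S') f \<and>
     openin (htop S') (f ` hpts S) \<and> oriented_map d S S' f"

definition hyp_iso :: "nat \<Rightarrow> 'p hyp \<Rightarrow> 'p hyp \<Rightarrow> ('p \<Rightarrow> 'p) \<Rightarrow> bool" where
  "hyp_iso d S S' f \<longleftrightarrow> homeomorphic_map (htop S) (htop S') f \<and> oriented_map d S S' f"

text \<open>A union of connected components, with the induced orientation.\<close>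

definition sub_hyp :: "nat \<Rightarrow> 'p hyp \<Rightarrow> 'p hyp \<Rightarrow> bool" where
  "sub_hyp d S' S \<longleftrightarrow> openin (htop S) (hpts S') \<and> closedin (htop S) (hpts S') \<and>
     htop S' = subtopology (htop S) (hpts S') \<and> oriented_map d S' S id"

definition disj_union_hyp :: "nat \<Rightarrow> 'p hyp \<Rightarrow> 'p hyp list \<Rightarrow> bool" where
  "disj_union_hyp d S Ss \<longleftrightarrow> (\<forall>i<length Ss. sub_hyp d (Ss ! i) S) \<and>
     (\<forall>i<length Ss. \<forall>j<length Ss. i \<noteq> j \<longrightarrow> hpts (Ss ! i) \<inter> hpts (Ss ! j) = {}) \<and>
     hpts S = (\<Union>i<length Ss. hpts (Ss ! i))"

text \<open>The boundary of a region is a hypersurface \<open>rbd\<close> of its own together with a map \<open>rbmap\<close>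
  into the region.  On the part of dimension \<open>d\<close> this map is a homeomorphism onto
  the manifold boundary; over the empty regions, which are the components in \<open>rthin\<close>,
  it is two-to-one, since an empty region is bounded by a hypersurface and by the same
  hypersurface with the opposite orientation.\<close>

record 'p region =
  rtop :: "'p topology"
  rthin :: "'p set"
  rori :: "'p \<Rightarrow> 'p chain set"
  rbd :: "'p hyp"
  rbmap :: "'p \<Rightarrow> 'p"

abbreviation rpts :: "'p region \<Rightarrow> 'p set" where
  "rpts M \<equiv> topspace (rtop M)"

definition rthick :: "'p region \<Rightarrow> 'p topology" where
  "rthick M = subtopology (rtop M) (rpts M - rthin M)"

definition rint :: "nat \<Rightarrow> 'p region \<Rightarrow> 'p set" where
  "rint d M = interior_points d (rthick M)"

text \<open>The boundary orientation is the image of the orientation under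
  \<open>H\<^sub>d(M, S) \<rightarrow> H\<^sub>d\<^sub>-\<^sub>1(S, S - {x})\<close>, where \<open>S\<close> is the complement of the interior points
  in a neighbourhood \<open>U\<close> of the boundary point \<open>x\<close>; near \<open>x\<close>, the set \<open>S\<close> is the boundary.\<close>

definition induced_boundary_orientation :: "nat \<Rightarrow> 'p region \<Rightarrow> bool" where
  "induced_boundary_orientation d M \<longleftrightarrow>
     (\<forall>x\<in>hpts (rbd M). rbmap M x \<notin> rthin M \<longrightarrow>
        (\<exists>U. openin (rtop M) U \<and> rbmap M x \<in> U \<and>
           (let S = rpts M - (U \<inter> rint d M) in
            \<exists>c \<in> carrier (relative_homology_group (int d) (rtop M) S).
              (\<forall>y \<in> U \<inter> rint d M.
                 hom_induced (int d) (rtop M) S (rtop M) (rpts M - {y}) id c = rori M y) \<and>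
              hom_relboundary (int d) (rtop M) S (S - {rbmap M x}) c =
              hom_induced (int d - 1) (htop (rbd M)) (hpts (rbd M) - {x})
                (subtopology (rtop M) S) (S - {rbmap M x}) (rbmap M) (hori (rbd M) x))))"

definition thin_boundary :: "nat \<Rightarrow> 'p region \<Rightarrow> bool" where
  "thin_boundary d M \<longleftrightarrow>
     (\<exists>E s t. htop E = subtopology (rtop M) (rthin M) \<and> hypersurface d E \<and>
        oriented_open_embedding d E (rbd M) s \<and>
        oriented_open_embedding d (rev_hyp d E) (rbd M) t \<and>
        (\<forall>e\<in>hpts E. rbmap M (s e) = e \<and> rbmap M (t e) = e) \<and>
        s ` hpts E \<inter> t ` hpts E = {} \<and>
        s ` hpts E \<union> t ` hpts E = {x \<in> hpts (rbd M). rbmap M x \<in> rthin M})"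

definition region :: "nat \<Rightarrow> 'p region \<Rightarrow> bool" where
  "region d M \<longleftrightarrow> openin (rtop M) (rthin M) \<and> closedin (rtop M) (rthin M) \<and>
     finite (connected_components_of (rtop M)) \<and>
     bordered_manifold_dim d (rthick M) \<and>
     orientation_on (int d) (rtop M) (rint d M) (rori M) \<and>
     hypersurface d (rbd M) \<and> continuous_map (htop (rbd M)) (rtop M) (rbmap M) \<and>
     homeomorphic_map
       (subtopology (htop (rbd M)) {x \<in> hpts (rbd M). rbmap M x \<notin> rthin M})
       (subtopology (rtop M) (rpts M - rthin M - rint d M)) (rbmap M) \<and>
     induced_boundary_orientation d M \<and> thin_boundary d M"

definition sub_region :: "nat \<Rightarrow> 'p region \<Rightarrow> 'p region \<Rightarrow> bool" where
  "sub_region d M' M \<longleftrightarrow> openin (rtop M) (rpts M') \<and> closedin (rtop M) (rpts M') \<and>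
     rtop M' = subtopology (rtop M) (rpts M') \<and> rthin M' = rthin M \<inter> rpts M' \<and>
     (\<forall>x\<in>rint d M'. local_push (int d) (rtop M') (rtop M) id x (rori M' x) = rori M x) \<and>
     sub_hyp d (rbd M') (rbd M) \<and>
     hpts (rbd M') = {x \<in> hpts (rbd M). rbmap M x \<in> rpts M'} \<and>
     (\<forall>x\<in>hpts (rbd M'). rbmap M' x = rbmap M x)"

definition disj_union_region :: "nat \<Rightarrow> 'p region \<Rightarrow> 'p region \<Rightarrow> 'p region \<Rightarrow> bool" where
  "disj_union_region d M M1 M2 \<longleftrightarrow> sub_region d M1 M \<and> sub_region d M2 M \<and>
     rpts M1 \<inter> rpts M2 = {} \<and> rpts M = rpts M1 \<union> rpts M2 \<and>
     disj_union_hyp d (rbd M) [rbd M1, rbd M2]"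


section \<open>Spacetime systems\<close>

text \<open>\<open>(S, S', f)\<close>: the hypersurface \<open>S'\<close> is a copy of \<open>S\<close>, by means of the map \<open>f\<close>.\<close>

type_synonym 'p hcopy = "'p hyp \<times> 'p hyp \<times> ('p \<Rightarrow> 'p)"

text \<open>The gluing of \<open>gM\<close> to \<open>gM1\<close> along \<open>gS\<close> and the reversed copy \<open>gS'\<close> of \<open>gS\<close>,
  with copy map \<open>gcopy\<close> and quotient map \<open>gquot\<close>.\<close>

record 'p gluing =
  gM :: "'p region"
  gS :: "'p hyp"
  gS' :: "'p hyp"
  gcopy :: "'p \<Rightarrow> 'p"
  gM1 :: "'p region"
  gquot :: "'p \<Rightarrow> 'p"

abbreviation ghcopy :: "'p gluing \<Rightarrow> 'p hcopy" where
  "ghcopy gl \<equiv> (gS gl, gS' gl, gcopy gl)"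

definition glue_rel :: "'p gluing \<Rightarrow> ('p \<times> 'p) set" where
  "glue_rel gl =
     (\<lambda>x. (rbmap (gM gl) x, rbmap (gM gl) (gcopy gl x))) ` hpts (gS gl)"

definition gluing :: "nat \<Rightarrow> 'p gluing \<Rightarrow> bool" where
  "gluing d gl \<longleftrightarrow>
     disj_union_hyp d (rbd (gM gl)) [rbd (gM1 gl), gS gl, rev_hyp d (gS' gl)] \<and>
     quotient_map (rtop (gM gl)) (rtop (gM1 gl)) (gquot gl) \<and>
     (\<forall>x\<in>rpts (gM gl). \<forall>y\<in>rpts (gM gl).
        gquot gl x = gquot gl y \<longleftrightarrow> (x, y) \<in> (glue_rel gl \<union> (glue_rel gl)\<inverse>)\<^sup>*) \<and>
     (\<forall>x\<in>rint d (gM gl). gquot gl x \<in> rint d (gM1 gl) \<and>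
        local_push (int d) (rtop (gM gl)) (rtop (gM1 gl)) (gquot gl) x (rori (gM gl) x) =
        rori (gM1 gl) (gquot gl x)) \<and>
     (\<forall>x\<in>hpts (rbd (gM1 gl)). rbmap (gM1 gl) x = gquot gl (rbmap (gM gl) x))"

text \<open>Which homeomorphisms count as identifications of a hypersurface with a copy, and which
  quotient maps as gluings, is part of the system: regions and hypersurfaces may carry additional
  structure, so not every homeomorphism qualifies.\<close>

record 'p spacetime =
  Hyps :: "'p hyp set"
  Regs :: "'p region set"
  Copies :: "'p hcopy set"
  Gluings :: "'p gluing set"

definition empty_region_of :: "nat \<Rightarrow> 'p spacetime \<Rightarrow> 'p hyp \<Rightarrow> 'p region \<Rightarrow> bool" where
  "empty_region_of d X S M \<longleftrightarrow> rthin M = rpts M \<and>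
     (\<exists>P N f f'. disj_union_hyp d (rbd M) [P, N] \<and>
        (S, P, f) \<in> Copies X \<and> (rev_hyp d S, N, f') \<in> Copies X \<and>
        (\<forall>x\<in>hpts S. rbmap M (f x) = rbmap M (f' x)))"

definition spacetime_system :: "nat \<Rightarrow> 'p spacetime \<Rightarrow> bool" where
  "spacetime_system d X \<longleftrightarrow> 1 \<le> d \<and>
     (\<forall>S\<in>Hyps X. hypersurface d S) \<and> (\<forall>M\<in>Regs X. region d M) \<and>
     (\<forall>S\<in>Hyps X. \<forall>C\<in>connected_components_of (htop S).
        \<exists>S'\<in>Hyps X. sub_hyp d S' S \<and> hpts S' = C) \<and>
     (\<forall>M\<in>Regs X. \<forall>C\<in>connected_components_of (rtop M).
        \<exists>M'\<in>Regs X. sub_region d M' M \<and> rpts M' = C) \<and>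
     (\<forall>S1\<in>Hyps X. \<forall>S2\<in>Hyps X. hpts S1 \<inter> hpts S2 = {} \<longrightarrow>
        (\<exists>S\<in>Hyps X. disj_union_hyp d S [S1, S2])) \<and>
     (\<forall>M1\<in>Regs X. \<forall>M2\<in>Regs X.
        rpts M1 \<inter> rpts M2 = {} \<and> hpts (rbd M1) \<inter> hpts (rbd M2) = {} \<longrightarrow>
        (\<exists>M\<in>Regs X. disj_union_region d M M1 M2)) \<and>
     (\<forall>M\<in>Regs X. rbd M \<in> Hyps X) \<and>
     (\<forall>S\<in>Hyps X. rev_hyp d S \<in> Hyps X) \<and>
     (\<forall>S\<in>Hyps X. \<exists>M\<in>Regs X. empty_region_of d X S M) \<and>
     (\<forall>(S, S', f)\<in>Copies X. S \<in> Hyps X \<and> S' \<in> Hyps X \<and> hyp_iso d S S' f) \<and>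
     (\<forall>gl\<in>Gluings X. gM gl \<in> Regs X \<and> gM1 gl \<in> Regs X \<and> ghcopy gl \<in> Copies X \<and>
        gluing d gl)"

text \<open>All regions and hypersurfaces are submanifolds of \<open>B\<close>; the point \<open>p\<close> lies at \<open>pos p\<close>
  in \<open>B\<close>.  Since the two parts of a disjoint union may overlap in \<open>B\<close> (as the
  two sides of the boundary of an empty region do), only connected components are embedded.
  A region may touch itself in \<open>B\<close> along its boundary, so only its interior is required to be embedded.
  A copy of a hypersurface is the same submanifold of \<open>B\<close>.\<close>

definition submanifolds_of :: "nat \<Rightarrow> 'b topology \<Rightarrow> ('p \<Rightarrow> 'b) \<Rightarrow> 'p spacetime \<Rightarrow> bool" where
  "submanifolds_of d B pos X \<longleftrightarrow> manifold_dim d B \<and>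
     (\<forall>S\<in>Hyps X. \<forall>C\<in>connected_components_of (htop S).
        embedding_map (subtopology (htop S) C) B pos) \<and>
     (\<forall>M\<in>Regs X. continuous_map (rtop M) B pos \<and>
        (\<forall>C\<in>connected_components_of (rtop M).
           embedding_map (subtopology (rtop M) (C \<inter> (rthin M \<union> rint d M))) B pos) \<and>
        (\<forall>x\<in>hpts (rbd M). pos (rbmap M x) = pos x)) \<and>
     (\<forall>(S, S', f)\<in>Copies X. \<forall>x\<in>hpts S. pos (f x) = pos x) \<and>
     (\<forall>gl\<in>Gluings X. \<forall>x\<in>rpts (gM gl). pos (gquot gl x) = pos x)"


section \<open>Classical affine field theory\<close>

definition affine_over :: "'a set \<Rightarrow> 'v::real_vector set \<Rightarrow> ('a \<Rightarrow> 'v \<Rightarrow> 'a) \<Rightarrow> bool" where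
  "affine_over A V t \<longleftrightarrow> A \<noteq> {} \<and>
     (\<forall>\<eta>\<in>A. t \<eta> 0 = \<eta> \<and> (\<forall>\<phi>\<in>V. t \<eta> \<phi> \<in> A \<and> (\<forall>\<phi>'\<in>V. t (t \<eta> \<phi>) \<phi>' = t \<eta> (\<phi> + \<phi>')))) \<and>
     (\<forall>\<eta>\<in>A. \<forall>\<eta>'\<in>A. \<exists>!\<phi>. \<phi> \<in> V \<and> t \<eta> \<phi> = \<eta>')"

definition aff_diff :: "'v set \<Rightarrow> ('a \<Rightarrow> 'v \<Rightarrow> 'a) \<Rightarrow> 'a \<Rightarrow> 'a \<Rightarrow> 'v" where
  "aff_diff V t \<eta> \<eta>' = (THE \<phi>. \<phi> \<in> V \<and> t \<eta>' \<phi> = \<eta>)"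

definition real_linear_on :: "'v::real_vector set \<Rightarrow> ('v \<Rightarrow> 'w::real_vector) \<Rightarrow> bool" where
  "real_linear_on V f \<longleftrightarrow> (\<forall>u\<in>V. \<forall>v\<in>V. f (u + v) = f u + f v) \<and>
     (\<forall>c. \<forall>u\<in>V. f (c *\<^sub>R u) = c *\<^sub>R f u)"

text \<open>The vector spaces of all hypersurfaces are real subspaces of one type, likewise those of
  all regions.  Complex structure and inner product are data of each hypersurface: they differ
  between a hypersurface and its reverse.  The fields \<open>prj..\<close> are the projections to the
  factors of a disjoint union, \<open>rev..\<close> the identifications for orientation reversal, \<open>cpy..\<close>
  those for copies, and \<open>glu..\<close> the injections of a gluing.\<close>

record ('p, 'a, 'l, 'ar, 'lr) field_theory =
  Aff :: "'p hyp \<Rightarrow> 'a set"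
  Lin :: "'p hyp \<Rightarrow> 'l set"
  plus_aff :: "'p hyp \<Rightarrow> 'a \<Rightarrow> 'l \<Rightarrow> 'a"
  cscale :: "'p hyp \<Rightarrow> complex \<Rightarrow> 'l \<Rightarrow> 'l"
  herm :: "'p hyp \<Rightarrow> 'l \<Rightarrow> 'l \<Rightarrow> complex"
  theta :: "'p hyp \<Rightarrow> 'a \<Rightarrow> 'l \<Rightarrow> real"
  brak :: "'p hyp \<Rightarrow> 'l \<Rightarrow> 'l \<Rightarrow> real"
  revA :: "'p hyp \<Rightarrow> 'a \<Rightarrow> 'a"
  revL :: "'p hyp \<Rightarrow> 'l \<Rightarrow> 'l"
  cpyA :: "'p hcopy \<Rightarrow> 'a \<Rightarrow> 'a"
  cpyL :: "'p hcopy \<Rightarrow> 'l \<Rightarrow> 'l"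
  prjA :: "'p hyp \<Rightarrow> 'p hyp \<Rightarrow> 'a \<Rightarrow> 'a"
  prjL :: "'p hyp \<Rightarrow> 'p hyp \<Rightarrow> 'l \<Rightarrow> 'l"
  AffR :: "'p region \<Rightarrow> 'ar set"
  LinR :: "'p region \<Rightarrow> 'lr set"
  plus_affR :: "'p region \<Rightarrow> 'ar \<Rightarrow> 'lr \<Rightarrow> 'ar"
  action :: "'p region \<Rightarrow> 'ar \<Rightarrow> real"
  bdA :: "'p region \<Rightarrow> 'ar \<Rightarrow> 'a"
  bdL :: "'p region \<Rightarrow> 'lr \<Rightarrow> 'l"
  prjAR :: "'p region \<Rightarrow> 'p region \<Rightarrow> 'ar \<Rightarrow> 'ar"
  prjLR :: "'p region \<Rightarrow> 'p region \<Rightarrow> 'lr \<Rightarrow> 'lr"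
  gluA :: "'p gluing \<Rightarrow> 'ar \<Rightarrow> 'ar"
  gluL :: "'p gluing \<Rightarrow> 'lr \<Rightarrow> 'lr"

context
  fixes F :: "('p, 'a, 'l::real_vector, 'ar, 'lr::real_vector) field_theory"
begin

definition gform :: "'p hyp \<Rightarrow> 'l \<Rightarrow> 'l \<Rightarrow> real" where
  "gform S \<phi> \<phi>' = Re (herm F S \<phi> \<phi>')"

definition omega :: "'p hyp \<Rightarrow> 'l \<Rightarrow> 'l \<Rightarrow> real" where
  "omega S \<phi> \<phi>' = Im (herm F S \<phi> \<phi>') / 2"

definition diffA :: "'p hyp \<Rightarrow> 'a \<Rightarrow> 'a \<Rightarrow> 'l" where
  "diffA S = aff_diff (Lin F S) (plus_aff F S)"

definition diffAR :: "'p region \<Rightarrow> 'ar \<Rightarrow> 'ar \<Rightarrow> 'lr" where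
  "diffAR M = aff_diff (LinR F M) (plus_affR F M)"

definition normL :: "'p hyp \<Rightarrow> 'l \<Rightarrow> real" where
  "normL S \<phi> = sqrt (gform S \<phi> \<phi>)"

definition topL :: "'p hyp \<Rightarrow> 'l topology" where
  "topL S = Metric_space.mtopology (Lin F S) (\<lambda>\<phi> \<phi>'. normL S (\<phi> - \<phi>'))"

definition topA :: "'p hyp \<Rightarrow> 'a topology" where
  "topA S = Metric_space.mtopology (Aff F S) (\<lambda>\<eta> \<eta>'. normL S (diffA S \<eta> \<eta>'))"

definition complex_separable_Hilbert :: "'p hyp \<Rightarrow> bool" where
  "complex_separable_Hilbert S \<longleftrightarrow>
     subspace (Lin F S) \<and>
     (\<forall>\<phi>\<in>Lin F S.
        (\<forall>z. cscale F S z \<phi> \<in> Lin F S) \<and>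
        (\<forall>r. cscale F S (of_real r) \<phi> = r *\<^sub>R \<phi>) \<and>
        (\<forall>z w. cscale F S (z + w) \<phi> = cscale F S z \<phi> + cscale F S w \<phi>) \<and>
        (\<forall>z w. cscale F S (z * w) \<phi> = cscale F S z (cscale F S w \<phi>)) \<and>
        (\<forall>z. \<forall>\<phi>'\<in>Lin F S. cscale F S z (\<phi> + \<phi>') = cscale F S z \<phi> + cscale F S z \<phi>')) \<and>
     (\<forall>\<phi>\<in>Lin F S. \<forall>\<phi>'\<in>Lin F S.
        herm F S \<phi>' \<phi> = cnj (herm F S \<phi> \<phi>') \<and>
        (\<forall>z. herm F S \<phi> (cscale F S z \<phi>') = z * herm F S \<phi> \<phi>') \<and>
        (\<forall>\<phi>''\<in>Lin F S. herm F S \<phi> (\<phi>' + \<phi>'') = herm F S \<phi> \<phi>' + herm F S \<phi> \<phi>'')) \<and>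
     (\<forall>\<phi>\<in>Lin F S. \<phi> \<noteq> 0 \<longrightarrow> 0 < Re (herm F S \<phi> \<phi>)) \<and>
     Metric_space.mcomplete (Lin F S) (\<lambda>\<phi> \<phi>'. normL S (\<phi> - \<phi>')) \<and>
     separable_space (topL S)"

definition axiom_C1 :: "'p spacetime \<Rightarrow> bool" where
  "axiom_C1 X \<longleftrightarrow> (\<forall>S\<in>Hyps X.
     complex_separable_Hilbert S \<and> affine_over (Aff F S) (Lin F S) (plus_aff F S) \<and>
     continuous_map (prod_topology (topA S) (topL S)) euclideanreal
       (\<lambda>(\<eta>, \<phi>). theta F S \<eta> \<phi>) \<and>
     (\<forall>\<eta>\<in>Aff F S. real_linear_on (Lin F S) (theta F S \<eta>)) \<and>
     continuous_map (prod_topology (topL S) (topL S)) euclideanreal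
       (\<lambda>(\<phi>, \<phi>'). brak F S \<phi> \<phi>') \<and>
     (\<forall>\<phi>\<in>Lin F S. real_linear_on (Lin F S) (brak F S \<phi>) \<and>
        real_linear_on (Lin F S) (\<lambda>\<phi>'. brak F S \<phi>' \<phi>)) \<and>
     (\<forall>\<eta>\<in>Aff F S. \<forall>\<phi>\<in>Lin F S. \<forall>\<phi>'\<in>Lin F S.
        brak F S \<phi> \<phi>' + theta F S \<eta> \<phi>' = theta F S (plus_aff F S \<eta> \<phi>) \<phi>') \<and>
     (\<forall>\<phi>\<in>Lin F S. \<forall>\<phi>'\<in>Lin F S.
        omega S \<phi> \<phi>' = brak F S \<phi> \<phi>' / 2 - brak F S \<phi>' \<phi> / 2))"

definition axiom_C2 :: "nat \<Rightarrow> 'p spacetime \<Rightarrow> bool" where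
  "axiom_C2 d X \<longleftrightarrow> (\<forall>S\<in>Hyps X. let R = rev_hyp d S in
     homeomorphic_map (topA S) (topA R) (revA F S) \<and>
     (\<forall>\<eta>\<in>Aff F S. revA F R (revA F S \<eta>) = \<eta>) \<and>
     (\<forall>\<phi>\<in>Lin F S. revL F S \<phi> \<in> Lin F R \<and> revL F R (revL F S \<phi>) = \<phi> \<and>
        (\<forall>\<phi>'\<in>Lin F S. revL F S (\<phi> + \<phi>') = revL F S \<phi> + revL F S \<phi>') \<and>
        (\<forall>z. revL F S (cscale F S z \<phi>) = cscale F R (cnj z) (revL F S \<phi>))) \<and>
     (\<forall>\<eta>\<in>Aff F S. \<forall>\<phi>\<in>Lin F S.
        revA F S (plus_aff F S \<eta> \<phi>) = plus_aff F R (revA F S \<eta>) (revL F S \<phi>) \<and>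
        theta F R (revA F S \<eta>) (revL F S \<phi>) = - theta F S \<eta> \<phi>) \<and>
     (\<forall>\<phi>\<in>Lin F S. \<forall>\<phi>'\<in>Lin F S.
        herm F R (revL F S \<phi>') (revL F S \<phi>) = cnj (herm F S \<phi>' \<phi>) \<and>
        brak F R (revL F S \<phi>) (revL F S \<phi>') = - brak F S \<phi> \<phi>'))"

definition axiom_C3 :: "nat \<Rightarrow> 'p spacetime \<Rightarrow> bool" where
  "axiom_C3 d X \<longleftrightarrow>
     (\<forall>S\<in>Hyps X. \<forall>Ss. set Ss \<subseteq> Hyps X \<and> disj_union_hyp d S Ss \<longrightarrow>
       homeomorphic_map (topA S) (product_topology (\<lambda>i. topA (Ss ! i)) {..<length Ss})
         (\<lambda>\<eta>. \<lambda>i\<in>{..<length Ss}. prjA F S (Ss ! i) \<eta>) \<and>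
       bij_betw (\<lambda>\<phi>. \<lambda>i\<in>{..<length Ss}. prjL F S (Ss ! i) \<phi>) (Lin F S)
         (PiE {..<length Ss} (\<lambda>i. Lin F (Ss ! i))) \<and>
       (\<forall>S'\<in>set Ss.
          (\<forall>\<phi>\<in>Lin F S. \<forall>\<phi>'\<in>Lin F S. prjL F S S' (\<phi> + \<phi>') = prjL F S S' \<phi> + prjL F S S' \<phi>') \<and>
          (\<forall>\<phi>\<in>Lin F S. \<forall>z. prjL F S S' (cscale F S z \<phi>) = cscale F S' z (prjL F S S' \<phi>)) \<and>
          (\<forall>\<eta>\<in>Aff F S. \<forall>\<phi>\<in>Lin F S.
             prjA F S S' (plus_aff F S \<eta> \<phi>) = plus_aff F S' (prjA F S S' \<eta>) (prjL F S S' \<phi>)) \<and>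
          (\<forall>\<eta>\<in>Aff F S. prjA F (rev_hyp d S) (rev_hyp d S') (revA F S \<eta>) =
             revA F S' (prjA F S S' \<eta>)) \<and>
          (\<forall>\<phi>\<in>Lin F S. prjL F (rev_hyp d S) (rev_hyp d S') (revL F S \<phi>) =
             revL F S' (prjL F S S' \<phi>)) \<and>
          (\<forall>Ss'. set Ss' \<subseteq> Hyps X \<and> disj_union_hyp d S' Ss' \<longrightarrow>
             (\<forall>S''\<in>set Ss'. (\<forall>\<eta>\<in>Aff F S. prjA F S' S'' (prjA F S S' \<eta>) = prjA F S S'' \<eta>) \<and>
                (\<forall>\<phi>\<in>Lin F S. prjL F S' S'' (prjL F S S' \<phi>) = prjL F S S'' \<phi>)))) \<and>
       (\<forall>\<phi>\<in>Lin F S. \<forall>\<phi>'\<in>Lin F S.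
          herm F S \<phi> \<phi>' =
            (\<Sum>i<length Ss. herm F (Ss ! i) (prjL F S (Ss ! i) \<phi>) (prjL F S (Ss ! i) \<phi>')) \<and>
          brak F S \<phi> \<phi>' =
            (\<Sum>i<length Ss. brak F (Ss ! i) (prjL F S (Ss ! i) \<phi>) (prjL F S (Ss ! i) \<phi>'))) \<and>
       (\<forall>\<eta>\<in>Aff F S. \<forall>\<phi>\<in>Lin F S. theta F S \<eta> \<phi> =
          (\<Sum>i<length Ss. theta F (Ss ! i) (prjA F S (Ss ! i) \<eta>) (prjL F S (Ss ! i) \<phi>)))) \<and>
     (\<forall>S\<in>Hyps X. (\<forall>\<eta>\<in>Aff F S. prjA F S S \<eta> = \<eta>) \<and> (\<forall>\<phi>\<in>Lin F S. prjL F S S \<phi> = \<phi>))"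

text \<open>The structure on a copy of a hypersurface is identified with that on the hypersurface.\<close>

definition copies_identified :: "'p spacetime \<Rightarrow> bool" where
  "copies_identified X \<longleftrightarrow> (\<forall>k\<in>Copies X. let S = fst k; S' = fst (snd k) in
     bij_betw (cpyA F k) (Aff F S) (Aff F S') \<and> bij_betw (cpyL F k) (Lin F S) (Lin F S') \<and>
     (\<forall>\<phi>\<in>Lin F S. (\<forall>\<phi>'\<in>Lin F S. cpyL F k (\<phi> + \<phi>') = cpyL F k \<phi> + cpyL F k \<phi>') \<and>
        (\<forall>z. cpyL F k (cscale F S z \<phi>) = cscale F S' z (cpyL F k \<phi>))) \<and>
     (\<forall>\<eta>\<in>Aff F S. \<forall>\<phi>\<in>Lin F S.
        cpyA F k (plus_aff F S \<eta> \<phi>) = plus_aff F S' (cpyA F k \<eta>) (cpyL F k \<phi>) \<and>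
        theta F S' (cpyA F k \<eta>) (cpyL F k \<phi>) = theta F S \<eta> \<phi>) \<and>
     (\<forall>\<phi>\<in>Lin F S. \<forall>\<phi>'\<in>Lin F S.
        herm F S' (cpyL F k \<phi>) (cpyL F k \<phi>') = herm F S \<phi> \<phi>' \<and>
        brak F S' (cpyL F k \<phi>) (cpyL F k \<phi>') = brak F S \<phi> \<phi>'))"

definition axiom_C4 :: "'p spacetime \<Rightarrow> bool" where
  "axiom_C4 X \<longleftrightarrow> (\<forall>M\<in>Regs X.
     subspace (LinR F M) \<and> affine_over (AffR F M) (LinR F M) (plus_affR F M))"

definition Aff_tilde :: "'p region \<Rightarrow> 'a set" where
  "Aff_tilde M = bdA F M ` AffR F M"

definition Lin_tilde :: "'p region \<Rightarrow> 'l set" where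
  "Lin_tilde M = bdL F M ` LinR F M"

definition axiom_C5 :: "'p spacetime \<Rightarrow> bool" where
  "axiom_C5 X \<longleftrightarrow> (\<forall>M\<in>Regs X.
     bdA F M ` AffR F M \<subseteq> Aff F (rbd M) \<and> bdL F M ` LinR F M \<subseteq> Lin F (rbd M) \<and>
     real_linear_on (LinR F M) (bdL F M) \<and>
     (\<forall>\<eta>\<in>AffR F M. \<forall>\<phi>\<in>LinR F M.
        bdA F M (plus_affR F M \<eta> \<phi>) = plus_aff F (rbd M) (bdA F M \<eta>) (bdL F M \<phi>)) \<and>
     closedin (topL (rbd M)) (Lin_tilde M) \<and>
     Lin_tilde M = {\<phi> \<in> Lin F (rbd M). \<forall>\<phi>'\<in>Lin_tilde M. omega (rbd M) \<phi> \<phi>' = 0} \<and>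
     (\<forall>\<eta>\<in>AffR F M. \<forall>\<eta>'\<in>AffR F M.
        (bdA F M \<eta> = bdA F M \<eta>' \<longrightarrow> action F M \<eta> = action F M \<eta>') \<and>
        action F M \<eta> = action F M \<eta>'
          - theta F (rbd M) (bdA F M \<eta>) (bdL F M (diffAR M \<eta> \<eta>')) / 2
          - theta F (rbd M) (bdA F M \<eta>') (bdL F M (diffAR M \<eta> \<eta>')) / 2))"

definition axiom_C6 :: "nat \<Rightarrow> 'p spacetime \<Rightarrow> bool" where
  "axiom_C6 d X \<longleftrightarrow>
     (\<forall>M\<in>Regs X. \<forall>M1\<in>Regs X. \<forall>M2\<in>Regs X. disj_union_region d M M1 M2 \<longrightarrow>
       bij_betw (\<lambda>\<eta>. (prjAR F M M1 \<eta>, prjAR F M M2 \<eta>)) (AffR F M) (AffR F M1 \<times> AffR F M2) \<and>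
       bij_betw (\<lambda>\<phi>. (prjLR F M M1 \<phi>, prjLR F M M2 \<phi>)) (LinR F M) (LinR F M1 \<times> LinR F M2) \<and>
       (\<forall>M'\<in>{M1, M2}.
          real_linear_on (LinR F M) (prjLR F M M') \<and>
          (\<forall>\<eta>\<in>AffR F M. \<forall>\<phi>\<in>LinR F M. prjAR F M M' (plus_affR F M \<eta> \<phi>) =
             plus_affR F M' (prjAR F M M' \<eta>) (prjLR F M M' \<phi>)) \<and>
          (\<forall>\<eta>\<in>AffR F M. prjA F (rbd M) (rbd M') (bdA F M \<eta>) = bdA F M' (prjAR F M M' \<eta>)) \<and>
          (\<forall>\<phi>\<in>LinR F M. prjL F (rbd M) (rbd M') (bdL F M \<phi>) = bdL F M' (prjLR F M M' \<phi>)) \<and>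
          (\<forall>M1'\<in>Regs X. \<forall>M2'\<in>Regs X. disj_union_region d M' M1' M2' \<longrightarrow>
             (\<forall>M''\<in>{M1', M2'}.
                (\<forall>\<eta>\<in>AffR F M. prjAR F M' M'' (prjAR F M M' \<eta>) = prjAR F M M'' \<eta>) \<and>
                (\<forall>\<phi>\<in>LinR F M. prjLR F M' M'' (prjLR F M M' \<phi>) = prjLR F M M'' \<phi>)))) \<and>
       (\<forall>\<eta>\<in>AffR F M. action F M \<eta> =
          action F M1 (prjAR F M M1 \<eta>) + action F M2 (prjAR F M M2 \<eta>)))"

text \<open>The two projections from the region \<open>gM\<close> of a gluing, via \<open>gS\<close> and via the reverse
  of its copy \<open>gS'\<close>, are compared in the space of the copy.\<close>

definition coincideA :: "nat \<Rightarrow> 'p gluing \<Rightarrow> 'ar \<Rightarrow> bool" where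
  "coincideA d gl \<eta> \<longleftrightarrow>
     cpyA F (ghcopy gl) (prjA F (rbd (gM gl)) (gS gl) (bdA F (gM gl) \<eta>)) =
     revA F (rev_hyp d (gS' gl))
       (prjA F (rbd (gM gl)) (rev_hyp d (gS' gl)) (bdA F (gM gl) \<eta>))"

definition coincideL :: "nat \<Rightarrow> 'p gluing \<Rightarrow> 'lr \<Rightarrow> bool" where
  "coincideL d gl \<phi> \<longleftrightarrow>
     cpyL F (ghcopy gl) (prjL F (rbd (gM gl)) (gS gl) (bdL F (gM gl) \<phi>)) =
     revL F (rev_hyp d (gS' gl))
       (prjL F (rbd (gM gl)) (rev_hyp d (gS' gl)) (bdL F (gM gl) \<phi>))"

definition axiom_C7 :: "nat \<Rightarrow> 'p spacetime \<Rightarrow> bool" where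
  "axiom_C7 d X \<longleftrightarrow> (\<forall>gl\<in>Gluings X. let M = gM gl; M1 = gM1 gl in
     inj_on (gluA F gl) (AffR F M1) \<and> inj_on (gluL F gl) (LinR F M1) \<and>
     real_linear_on (LinR F M1) (gluL F gl) \<and>
     (\<forall>\<eta>\<in>AffR F M1. \<forall>\<phi>\<in>LinR F M1.
        gluA F gl (plus_affR F M1 \<eta> \<phi>) = plus_affR F M (gluA F gl \<eta>) (gluL F gl \<phi>)) \<and>
     gluA F gl ` AffR F M1 = {\<eta> \<in> AffR F M. coincideA d gl \<eta>} \<and>
     gluL F gl ` LinR F M1 = {\<phi> \<in> LinR F M. coincideL d gl \<phi>} \<and>
     (\<forall>\<eta>\<in>AffR F M1. action F M1 \<eta> = action F M (gluA F gl \<eta>) \<and>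
        bdA F M1 \<eta> = prjA F (rbd M) (rbd M1) (bdA F M (gluA F gl \<eta>))) \<and>
     (\<forall>\<phi>\<in>LinR F M1. bdL F M1 \<phi> = prjL F (rbd M) (rbd M1) (bdL F M (gluL F gl \<phi>))))"

definition affine_field_theory :: "nat \<Rightarrow> 'p spacetime \<Rightarrow> bool" where
  "affine_field_theory d X \<longleftrightarrow> axiom_C1 X \<and> axiom_C2 d X \<and> axiom_C3 d X \<and>
     copies_identified X \<and> axiom_C4 X \<and> axiom_C5 X \<and> axiom_C6 d X \<and> axiom_C7 d X"

definition global_solution :: "nat \<Rightarrow> 'p spacetime \<Rightarrow> ('p hyp \<Rightarrow> 'a) \<Rightarrow> bool" where
  "global_solution d X \<phi> \<longleftrightarrow>
     (\<forall>S\<in>Hyps X. \<phi> S \<in> Aff F S) \<and>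
     (\<forall>S\<in>Hyps X. \<phi> (rev_hyp d S) = revA F S (\<phi> S)) \<and>
     (\<forall>S\<in>Hyps X. \<forall>Ss. set Ss \<subseteq> Hyps X \<and> disj_union_hyp d S Ss \<longrightarrow>
        (\<forall>S'\<in>set Ss. prjA F S S' (\<phi> S) = \<phi> S')) \<and>
     (\<forall>M\<in>Regs X. \<phi> (rbd M) \<in> Aff_tilde M) \<and>
     (\<forall>(S, S', f)\<in>Copies X. \<phi> S' = cpyA F (S, S', f) (\<phi> S))"

text \<open>The action as a function on \<open>Aff_tilde M\<close>.\<close>

definition action_tilde :: "'p region \<Rightarrow> 'a \<Rightarrow> real" where
  "action_tilde M \<eta> = (THE s. \<exists>\<zeta>\<in>AffR F M. bdA F M \<zeta> = \<eta> \<and> action F M \<zeta> = s)"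

definition shifted_theory ::
    "('p hyp \<Rightarrow> 'a) \<Rightarrow> ('p, 'a, 'l, 'ar, 'lr) field_theory" where
  "shifted_theory \<phi> =
     F\<lparr>action := \<lambda>M \<zeta>. action F M \<zeta> - action_tilde M (\<phi> (rbd M))\<rparr>"

end


section \<open>Gaussian measures\<close>

text \<open>Here \<open>V\<close> is a real Hilbert space with inner product \<open>g\<close>, \<open>top_dual V g\<close> its topological
  dual and \<open>hat V g\<close> the algebraic dual of the latter.\<close>

definition top_dual :: "'l::real_vector set \<Rightarrow> ('l \<Rightarrow> 'l \<Rightarrow> real) \<Rightarrow> ('l \<Rightarrow> real) set" where
  "top_dual V g = {f \<in> extensional V. real_linear_on V f \<and>
     (\<exists>C. \<forall>v\<in>V. \<bar>f v\<bar> \<le> C * sqrt (g v v))}"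

definition hat :: "'l::real_vector set \<Rightarrow> ('l \<Rightarrow> 'l \<Rightarrow> real) \<Rightarrow> (('l \<Rightarrow> real) \<Rightarrow> real) set" where
  "hat V g = {x \<in> extensional (top_dual V g).
     (\<forall>f\<in>top_dual V g. \<forall>f'\<in>top_dual V g. x (\<lambda>v\<in>V. f v + f' v) = x f + x f') \<and>
     (\<forall>c. \<forall>f\<in>top_dual V g. x (\<lambda>v\<in>V. c * f v) = c * x f)}"

definition hat_embed ::
    "'l::real_vector set \<Rightarrow> ('l \<Rightarrow> 'l \<Rightarrow> real) \<Rightarrow> 'l \<Rightarrow> ('l \<Rightarrow> real) \<Rightarrow> real" where
  "hat_embed V g v = (\<lambda>f\<in>top_dual V g. f v)"

text \<open>The extension of \<open>g \<xi>\<close> from \<open>V\<close> to \<open>hat V g\<close>.\<close>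

definition hat_form ::
    "'l set \<Rightarrow> ('l \<Rightarrow> 'l \<Rightarrow> real) \<Rightarrow> 'l \<Rightarrow> (('l \<Rightarrow> real) \<Rightarrow> real) \<Rightarrow> real" where
  "hat_form V g \<xi> x = x (\<lambda>v\<in>V. g \<xi> v)"

text \<open>The centred Gaussian probability measure of covariance \<open>c * g\<close>, on the
  \<open>\<sigma>\<close>-algebra generated by the evaluations.\<close>

definition gaussian_measure :: "'l::real_vector set \<Rightarrow> ('l \<Rightarrow> 'l \<Rightarrow> real) \<Rightarrow> real \<Rightarrow>
    (('l \<Rightarrow> real) \<Rightarrow> real) measure \<Rightarrow> bool" where
  "gaussian_measure V g c \<nu> \<longleftrightarrow> prob_space \<nu> \<and> space \<nu> = hat V g \<and>
     sets \<nu> = sigma_sets (hat V g)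
       {{x \<in> hat V g. x f \<in> T} | f T. f \<in> top_dual V g \<and> T \<in> sets borel} \<and>
     (\<forall>\<xi>\<in>V. (\<integral>x. exp (\<i> * of_real (hat_form V g \<xi> x)) \<partial>\<nu>) = of_real (exp (- c / 2 * g \<xi> \<xi>)))"

text \<open>Extension of a function from \<open>V\<close> to \<open>hat V g\<close>.  As \<open>V\<close> is a null set if it is of infinite dimension,
  this is meant in the sense of Segal and Gross: the extension is the limit in
  probability of \<open>f \<circ> P\<^sub>W\<close> along the directed set of finite-dimensional subspaces \<open>W\<close> of \<open>V\<close>, where
  \<open>P\<^sub>W\<close> is the orthogonal projection, which is defined on all of \<open>hat V g\<close>.  The subspaces are
  given by orthonormal bases.\<close>

definition orthonormal_set :: "'l set \<Rightarrow> ('l \<Rightarrow> 'l \<Rightarrow> real) \<Rightarrow> 'l set \<Rightarrow> bool" where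
  "orthonormal_set V g E \<longleftrightarrow> finite E \<and> E \<subseteq> V \<and>
     (\<forall>e\<in>E. \<forall>e'\<in>E. g e e' = (if e = e' then 1 else 0))"

definition hat_proj :: "'l::real_vector set \<Rightarrow> ('l \<Rightarrow> 'l \<Rightarrow> real) \<Rightarrow> 'l set \<Rightarrow>
    (('l \<Rightarrow> real) \<Rightarrow> real) \<Rightarrow> 'l" where
  "hat_proj V g E x = (\<Sum>e\<in>E. hat_form V g e x *\<^sub>R e)"

definition extends_to_hat :: "'l::real_vector set \<Rightarrow> ('l \<Rightarrow> 'l \<Rightarrow> real) \<Rightarrow>
    (('l \<Rightarrow> real) \<Rightarrow> real) measure \<Rightarrow> ('l \<Rightarrow> complex) \<Rightarrow> ((('l \<Rightarrow> real) \<Rightarrow> real) \<Rightarrow> complex) \<Rightarrow> bool" where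
  "extends_to_hat V g \<nu> f G \<longleftrightarrow> G \<in> borel_measurable \<nu> \<and>
     (\<forall>\<epsilon>>0. \<forall>\<delta>>0. \<exists>E0. orthonormal_set V g E0 \<and>
        (\<forall>E. orthonormal_set V g E \<and> span E0 \<subseteq> span E \<longrightarrow>
           (\<lambda>x. f (hat_proj V g E x)) \<in> borel_measurable \<nu> \<and>
           measure \<nu> {x \<in> space \<nu>. \<epsilon> < cmod (f (hat_proj V g E x) - G x)} < \<delta>))"


section \<open>States and amplitudes\<close>

definition entire_function :: "((nat \<Rightarrow> complex) \<Rightarrow> complex) \<Rightarrow> bool" where
  "entire_function h \<longleftrightarrow> continuous_on UNIV h \<and>
     (\<forall>z i. (\<lambda>w. h (z(i := w))) holomorphic_on UNIV)"

context
  fixes F :: "('p, 'a, 'l::real_vector, 'ar, 'lr::real_vector) field_theory"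
    and \<nu> :: "'p hyp \<Rightarrow> (('l \<Rightarrow> real) \<Rightarrow> real) measure"
    and \<nu>t :: "'p region \<Rightarrow> (('l \<Rightarrow> real) \<Rightarrow> real) measure"
begin

abbreviation hatL :: "'p hyp \<Rightarrow> (('l \<Rightarrow> real) \<Rightarrow> real) set" where
  "hatL S \<equiv> hat (Lin F S) (gform F S)"

definition gaussian_measures :: "'p spacetime \<Rightarrow> bool" where
  "gaussian_measures X \<longleftrightarrow>
     (\<forall>S\<in>Hyps X. gaussian_measure (Lin F S) (gform F S) 1 (\<nu> S)) \<and>
     (\<forall>M\<in>Regs X. gaussian_measure (Lin_tilde F M) (gform F (rbd M)) 2 (\<nu>t M))"

text \<open>The complex linear extension of \<open>herm F S \<xi>\<close> to \<open>hatL S\<close>.\<close>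

definition hat_herm :: "'p hyp \<Rightarrow> 'l \<Rightarrow> (('l \<Rightarrow> real) \<Rightarrow> real) \<Rightarrow> complex" where
  "hat_herm S \<xi> x = Complex (x (\<lambda>v\<in>Lin F S. Re (herm F S \<xi> v))) (x (\<lambda>v\<in>Lin F S. Im (herm F S \<xi> v)))"

definition holomorphic_cylinder :: "'p hyp \<Rightarrow> ((('l \<Rightarrow> real) \<Rightarrow> real) \<Rightarrow> complex) \<Rightarrow> bool" where
  "holomorphic_cylinder S p \<longleftrightarrow>
     (\<exists>k \<xi> h. (\<forall>i<k. \<xi> i \<in> Lin F S) \<and> entire_function h \<and>
        (\<forall>x\<in>hatL S. p x = h (\<lambda>i. if i < k then hat_herm S (\<xi> i) x else 0)))"

text \<open>\<open>G\<close> is a square-integrable holomorphic function on \<open>hatL S\<close> and \<open>\<kappa>\<close> its restriction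
  to \<open>Lin F S\<close>.  The holomorphic functions are the limits in square mean
  of holomorphic functions of finitely many variables; they are defined almost everywhere, but the values on
  the null set \<open>Lin F S\<close> of the approximating functions converge, and independently of the approximation.\<close>

definition square_integrable_holomorphic ::
    "'p hyp \<Rightarrow> ('l \<Rightarrow> complex) \<Rightarrow> ((('l \<Rightarrow> real) \<Rightarrow> real) \<Rightarrow> complex) \<Rightarrow> bool" where
  "square_integrable_holomorphic S \<kappa> G \<longleftrightarrow>
     G \<in> borel_measurable (\<nu> S) \<and> integrable (\<nu> S) (\<lambda>x. (cmod (G x))\<^sup>2) \<and>
     (\<exists>p. (\<forall>n::nat. holomorphic_cylinder S (p n) \<and> integrable (\<nu> S) (\<lambda>x. (cmod (p n x))\<^sup>2)) \<and>
        (\<lambda>n. \<integral>x. (cmod (p n x - G x))\<^sup>2 \<partial>(\<nu> S)) \<longlonglongrightarrow> 0 \<and>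
        (\<forall>v\<in>Lin F S. (\<lambda>n. p n (hat_embed (Lin F S) (gform F S) v)) \<longlonglongrightarrow> \<kappa> v))"

definition alpha :: "'p hyp \<Rightarrow> 'a \<Rightarrow> 'a \<Rightarrow> complex" where
  "alpha S \<eta> \<phi> = exp (\<i> / 2 * of_real (theta F S \<eta> (diffA F S \<phi> \<eta>))
     + \<i> / 2 * of_real (theta F S \<phi> (diffA F S \<phi> \<eta>))
     - of_real (gform F S (diffA F S \<phi> \<eta>) (diffA F S \<phi> \<eta>) / 4))"

text \<open>The function \<open>\<kappa>\<close> in the decomposition \<open>\<psi> \<phi> = \<kappa> (\<phi> - \<eta>) * alpha S \<eta> \<phi>\<close>.\<close>

definition chi :: "'p hyp \<Rightarrow> 'a \<Rightarrow> ('a \<Rightarrow> complex) \<Rightarrow> 'l \<Rightarrow> complex" where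
  "chi S \<eta> \<psi> v = \<psi> (plus_aff F S \<eta> v) / alpha S \<eta> (plus_aff F S \<eta> v)"

definition state_space :: "'p hyp \<Rightarrow> ('a \<Rightarrow> complex) set" where
  "state_space S = {\<psi> \<in> extensional (Aff F S).
     \<exists>\<eta>\<in>Aff F S. \<exists>G. square_integrable_holomorphic S (chi S \<eta> \<psi>) G}"

definition coherent :: "'p hyp \<Rightarrow> 'a \<Rightarrow> 'a \<Rightarrow> complex" where
  "coherent S \<zeta> = (\<lambda>\<phi>\<in>Aff F S. exp (\<i> / 2 * of_real (theta F S \<zeta> (diffA F S \<phi> \<zeta>))
     + \<i> / 2 * of_real (theta F S \<phi> (diffA F S \<phi> \<zeta>))
     - of_real (gform F S (diffA F S \<phi> \<zeta>) (diffA F S \<phi> \<zeta>) / 4)))"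

definition iota :: "nat \<Rightarrow> 'p hyp \<Rightarrow> ('a \<Rightarrow> complex) \<Rightarrow> 'a \<Rightarrow> complex" where
  "iota d S \<psi> = (\<lambda>\<phi>\<in>Aff F (rev_hyp d S). cnj (\<psi> (revA F (rev_hyp d S) \<phi>)))"

text \<open>The tensor product of states on the parts \<open>Ss\<close> of the disjoint union \<open>S\<close>.\<close>

definition tensor :: "'p hyp \<Rightarrow> 'p hyp list \<Rightarrow> ('a \<Rightarrow> complex) list \<Rightarrow> 'a \<Rightarrow> complex" where
  "tensor S Ss \<psi>s = (\<lambda>\<phi>\<in>Aff F S. \<Prod>i<length Ss. (\<psi>s ! i) (prjA F S (Ss ! i) \<phi>))"

definition copy_state :: "'p hcopy \<Rightarrow> ('a \<Rightarrow> complex) \<Rightarrow> 'a \<Rightarrow> complex" where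
  "copy_state k \<psi> =
     (\<lambda>\<phi>\<in>Aff F (fst (snd k)). \<psi> (inv_into (Aff F (fst k)) (cpyA F k) \<phi>))"

text \<open>The amplitude is a partial function on states.  Its defining formula is required for every
  base point, so that it has at most one value.\<close>

definition has_amplitude :: "'p region \<Rightarrow> ('a \<Rightarrow> complex) \<Rightarrow> complex \<Rightarrow> bool" where
  "has_amplitude M \<psi> z \<longleftrightarrow> \<psi> \<in> state_space (rbd M) \<and>
     (\<forall>\<eta>\<in>AffR F M. \<exists>G.
        extends_to_hat (Lin_tilde F M) (gform F (rbd M)) (\<nu>t M) (chi (rbd M) (bdA F M \<eta>) \<psi>) G \<and>
        integrable (\<nu>t M) G \<and>
        z = exp (\<i> * of_real (action F M \<eta>)) * (\<integral>x. G x \<partial>(\<nu>t M)))"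

definition amplitude_defined :: "'p region \<Rightarrow> ('a \<Rightarrow> complex) \<Rightarrow> bool" where
  "amplitude_defined M \<psi> \<longleftrightarrow> (\<exists>z. has_amplitude M \<psi> z)"

definition amplitude :: "'p region \<Rightarrow> ('a \<Rightarrow> complex) \<Rightarrow> complex" where
  "amplitude M \<psi> = (THE z. has_amplitude M \<psi> z)"

definition gluing_state :: "nat \<Rightarrow> 'p gluing \<Rightarrow> 'ar \<Rightarrow> 'l \<Rightarrow> 'a \<Rightarrow> complex" where
  "gluing_state d gl \<eta> \<xi> =
     (let S = gS gl; S' = gS' gl; S1 = rbd (gM1 gl);
          \<eta>0 = prjA F (rbd (gM gl)) S (bdA F (gM gl) (gluA F gl \<eta>));
          K = coherent S (plus_aff F S \<eta>0 \<xi>)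
      in tensor (rbd (gM gl)) [S1, S, rev_hyp d S']
           [coherent S1 (bdA F (gM1 gl) \<eta>), K, iota d S' (copy_state (ghcopy gl) K)])"

definition integrability_condition :: "nat \<Rightarrow> 'p gluing \<Rightarrow> bool" where
  "integrability_condition d gl \<longleftrightarrow>
     (\<exists>\<eta>\<in>AffR F (gM1 gl).
        (\<forall>\<xi>\<in>Lin F (gS gl). amplitude_defined (gM gl) (gluing_state d gl \<eta> \<xi>)) \<and>
        (\<exists>G. extends_to_hat (Lin F (gS gl)) (gform F (gS gl)) (\<nu> (gS gl))
             (\<lambda>\<xi>. amplitude (gM gl) (gluing_state d gl \<eta> \<xi>) *
                 of_real (exp (gform F (gS gl) \<xi> \<xi> / 2))) G \<and>
           integrable (\<nu> (gS gl)) G \<and> (\<integral>x. G x \<partial>(\<nu> (gS gl))) \<noteq> 0))"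


section \<open>Vacuum axioms\<close>

definition vacuum_V1 ::
    "'p spacetime \<Rightarrow> ('p hyp \<Rightarrow> 'a) \<Rightarrow> ('p hyp \<Rightarrow> 'a \<Rightarrow> complex) \<Rightarrow> bool" where
  "vacuum_V1 X \<phi> \<psi>0 \<longleftrightarrow> (\<forall>S\<in>Hyps X. \<psi>0 S = coherent S (\<phi> S) \<and> \<psi>0 S \<in> state_space S)"

definition vacuum_V2 :: "nat \<Rightarrow> 'p spacetime \<Rightarrow> ('p hyp \<Rightarrow> 'a \<Rightarrow> complex) \<Rightarrow> bool" where
  "vacuum_V2 d X \<psi>0 \<longleftrightarrow> (\<forall>S\<in>Hyps X. \<psi>0 (rev_hyp d S) = iota d S (\<psi>0 S))"

definition vacuum_V3 :: "nat \<Rightarrow> 'p spacetime \<Rightarrow> ('p hyp \<Rightarrow> 'a \<Rightarrow> complex) \<Rightarrow> bool" where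
  "vacuum_V3 d X \<psi>0 \<longleftrightarrow> (\<forall>S\<in>Hyps X. \<forall>Ss. set Ss \<subseteq> Hyps X \<and> disj_union_hyp d S Ss \<longrightarrow>
     \<psi>0 S = tensor S Ss (map \<psi>0 Ss))"

definition vacuum_V5 :: "'p spacetime \<Rightarrow> ('p hyp \<Rightarrow> 'a \<Rightarrow> complex) \<Rightarrow> bool" where
  "vacuum_V5 X \<psi>0 \<longleftrightarrow>
     (\<forall>M\<in>Regs X. amplitude_defined M (\<psi>0 (rbd M)) \<and> amplitude M (\<psi>0 (rbd M)) = 1)"

definition vacuum_V5' :: "'p spacetime \<Rightarrow> ('p hyp \<Rightarrow> 'a \<Rightarrow> complex) \<Rightarrow> bool" where
  "vacuum_V5' X \<psi>0 \<longleftrightarrow>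
     (\<forall>M\<in>Regs X. amplitude_defined M (\<psi>0 (rbd M)) \<and> cmod (amplitude M (\<psi>0 (rbd M))) = 1)"

end

end

theory Submission
  imports Defs
begin

text \<open>
  Relative to a base point \<open>\<eta>\<close>, the coherent state of \<open>\<zeta> = \<eta> + \<tau>\<close> has the holomorphic part
  \<open>v \<mapsto> exp (- \<i>/2 (\<theta>(\<eta>, \<tau>) + \<theta>(\<zeta>, \<tau>)) - 1/4 g(\<tau>, \<tau>) + 1/2 {\<tau>, v})\<close>.
  On the Lagrangian subspace of a region \<open>{\<tau>, v}\<close> is real, and the Gaussian integral of
  \<open>exp (1/2 g(\<tau>, v))\<close> with covariance \<open>2 g\<close> is \<open>exp (1/4 g(\<tau>, \<tau>))\<close>.  What remains is a phase,
  which by the action identity of (C5) turns \<open>exp (\<i> S(\<eta>))\<close> into \<open>exp (\<i> S(\<zeta>))\<close>.  The vacuum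
  phases \<open>S(\<phi>(\<partial>M))\<close> are additive under disjoint unions and invariant under gluings because the
  global solution is compatible with restriction, reversal and copies, so they can be subtracted
  from the action.
\<close>

section \<open>Gaussian variables on the algebraic dual\<close>

text \<open>The Gaussian measures are given only by their characteristic functionals, and in
  infinite dimension \<open>Lin F S\<close> is a null set of its algebraic dual. Two obstacles
  follow. A real exponential cannot be integrated by inserting an imaginary argument; instead the
  law of a single functional is identified by Levy uniqueness as a scaled standard normal law. And
  extending a function off the Hilbert space means a limit in probability along finite-dimensional
  subspaces. For an exponential of one functional this limit is attained as soon as the subspace
  contains the vector; Gram-Schmidt makes the subspaces directed, so extensions are unique almost
  everywhere. That uniqueness turns the relation \<open>has_amplitude\<close> into a partial
  function, so that amplitudes can be evaluated and compared for two actions. All spaces are subsets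
  of one type with inner products that vary with the hypersurface, hence an inner product relative
  to a carrier.\<close>

locale inner_on =
  fixes V :: "'l::real_vector set" and g :: "'l \<Rightarrow> 'l \<Rightarrow> real"
  assumes subspace: "subspace V"
    and sym: "\<lbrakk>u \<in> V; v \<in> V\<rbrakk> \<Longrightarrow> g u v = g v u"
    and add_right: "\<lbrakk>u \<in> V; v \<in> V; w \<in> V\<rbrakk> \<Longrightarrow> g u (v + w) = g u v + g u w"
    and scale_right: "\<lbrakk>u \<in> V; v \<in> V\<rbrakk> \<Longrightarrow> g u (c *\<^sub>R v) = c * g u v"
    and pos: "\<lbrakk>u \<in> V; u \<noteq> 0\<rbrakk> \<Longrightarrow> 0 < g u u"
begin

lemma in_V [simp]:
  "0 \<in> V"
  "\<lbrakk>u \<in> V; v \<in> V\<rbrakk> \<Longrightarrow> u + v \<in> V"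
  "\<lbrakk>u \<in> V; v \<in> V\<rbrakk> \<Longrightarrow> u - v \<in> V"
  "u \<in> V \<Longrightarrow> c *\<^sub>R u \<in> V"
  using subspace by (auto simp: subspace_0 subspace_add subspace_diff subspace_scale)

lemma uminus_in_V [simp]: "u \<in> V \<Longrightarrow> - u \<in> V"
  using subspace by (rule subspace_neg)

lemma sum_in_V: "(\<And>i. i \<in> I \<Longrightarrow> f i \<in> V) \<Longrightarrow> sum f I \<in> V"
  using subspace by (rule subspace_sum)

lemma add_left: "\<lbrakk>u \<in> V; v \<in> V; w \<in> V\<rbrakk> \<Longrightarrow> g (u + v) w = g u w + g v w"
  using sym add_right by (metis in_V(2))

lemma scale_left: "\<lbrakk>u \<in> V; v \<in> V\<rbrakk> \<Longrightarrow> g (c *\<^sub>R u) v = c * g u v"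
  using sym scale_right by (metis in_V(4))

lemma minus_right: "\<lbrakk>u \<in> V; v \<in> V\<rbrakk> \<Longrightarrow> g u (- v) = - g u v"
  using scale_right[of u v "-1"] by simp

lemma minus_left: "\<lbrakk>u \<in> V; v \<in> V\<rbrakk> \<Longrightarrow> g (- u) v = - g u v"
  using scale_left[of u v "-1"] by simp

lemma diff_right: "\<lbrakk>u \<in> V; v \<in> V; w \<in> V\<rbrakk> \<Longrightarrow> g u (v - w) = g u v - g u w"
  using add_right[of u v "- w"] minus_right by simp

lemma diff_left: "\<lbrakk>u \<in> V; v \<in> V; w \<in> V\<rbrakk> \<Longrightarrow> g (u - v) w = g u w - g v w"
  using add_left[of u "- v" w] minus_left by simp

lemma zero_right [simp]: "u \<in> V \<Longrightarrow> g u 0 = 0"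
  using scale_right[of u 0 0] by simp

lemma zero_left [simp]: "u \<in> V \<Longrightarrow> g 0 u = 0"
  using scale_left[of 0 u 0] by simp

lemma nonneg: "u \<in> V \<Longrightarrow> 0 \<le> g u u"
  using pos[of u] by (cases "u = 0") auto

lemma sum_right:
  "\<lbrakk>u \<in> V; \<And>i. i \<in> I \<Longrightarrow> f i \<in> V\<rbrakk> \<Longrightarrow> g u (sum f I) = (\<Sum>i\<in>I. g u (f i))"
  by (induction I rule: infinite_finite_induct) (auto simp: add_right sum_in_V)

lemma Cauchy_Schwarz:
  assumes "u \<in> V" "v \<in> V"
  shows "\<bar>g u v\<bar> \<le> sqrt (g u u) * sqrt (g v v)"
proof (cases "v = 0")
  case True
  then show ?thesis using assms by simp
next
  case False
  then have p: "0 < g v v" using assms pos by blast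
  \<comment> \<open>\<open>w\<close> is the component of \<open>u\<close> orthogonal to
    \<open>v\<close>; the inequality is the nonnegativity of \<open>g w w\<close>.\<close>
  define w where "w = u - (g u v / g v v) *\<^sub>R v"
  have "0 \<le> g w w" using assms by (simp add: w_def nonneg)
  also have "g w w = g u u - (g u v)\<^sup>2 / g v v"
    using assms p sym[of v u]
    by (simp add: w_def diff_left diff_right scale_left scale_right field_simps power2_eq_square)
  finally have "(g u v)\<^sup>2 \<le> g u u * g v v"
    using p by (simp add: field_simps)
  then have "sqrt ((g u v)\<^sup>2) \<le> sqrt (g u u * g v v)"
    by (rule real_sqrt_le_mono)
  then show ?thesis by (simp add: real_sqrt_mult)
qed

section \<open>Orthonormal bases of finite-dimensional subspaces\<close>

lemma orthonormal_expansion: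
  assumes E: "orthonormal_set V g E" and u: "u \<in> span E"
  shows "(\<Sum>e\<in>E. g e u *\<^sub>R e) = u"
proof -
  have fin: "finite E" and EV: "E \<subseteq> V" using E by (auto simp: orthonormal_set_def)
  from u fin obtain a where a: "u = (\<Sum>e\<in>E. a e *\<^sub>R e)"
    by (auto simp: span_finite)
  have "g e u = a e" if e: "e \<in> E" for e
  proof -
    have "g e u = (\<Sum>e'\<in>E. g e (a e' *\<^sub>R e'))"
      unfolding a by (rule sum_right) (use e EV in auto)
    also have "\<dots> = (\<Sum>e'\<in>E. if e' = e then a e' else 0)"
      by (rule sum.cong) (use E e EV in \<open>auto simp: scale_right orthonormal_set_def subset_iff\<close>)
    also have "\<dots> = a e" using fin e by simp
    finally show ?thesis .
  qed
  then show ?thesis by (simp add: a)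
qed

text \<open>One Gram-Schmidt step: if \<open>v\<close> is not yet in \<open>span E\<close>, what
  remains after removing its projection is nonzero and can be normalised.\<close>

lemma orthonormal_insert:
  assumes E: "orthonormal_set V g E" and v: "v \<in> V"
  obtains E' where "orthonormal_set V g E'" "span (insert v E) \<subseteq> span E'"
proof (cases "v \<in> span E")
  case True
  then show ?thesis using that[OF E] by (simp add: span_redundant)
next
  case False
  have fin: "finite E" and EV: "E \<subseteq> V" using E by (auto simp: orthonormal_set_def)
  define s where "s = (\<Sum>e\<in>E. g e v *\<^sub>R e)"
  define w where "w = v - s"
  have sV: "s \<in> V" unfolding s_def by (rule sum_in_V) (use EV in auto)
  have s: "s \<in> span E" unfolding s_def by (intro span_sum span_scale span_base)
  have w0: "w \<noteq> 0" using s False by (auto simp: w_def)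
  have wV: "w \<in> V" using v sV by (simp add: w_def)
  have p: "0 < g w w" using w0 wV pos by blast
  have orth: "g e w = 0" if e: "e \<in> E" for e
  proof -
    have "g e s = (\<Sum>e'\<in>E. g e (g e' v *\<^sub>R e'))"
      unfolding s_def by (rule sum_right) (use e EV in auto)
    also have "\<dots> = (\<Sum>e'\<in>E. if e' = e then g e' v else 0)"
      by (rule sum.cong) (use E e EV in \<open>auto simp: scale_right orthonormal_set_def subset_iff\<close>)
    also have "\<dots> = g e v" using fin e by simp
    finally show ?thesis using e EV v sV by (auto simp: w_def diff_right)
  qed
  define n where "n = (1 / sqrt (g w w)) *\<^sub>R w"
  have nV: "n \<in> V" using wV by (simp add: n_def)
  have nn: "g n n = 1" using p wV by (simp add: n_def scale_left scale_right field_simps)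
  have en: "g e n = 0" if "e \<in> E" for e using orth that EV wV by (auto simp: n_def scale_right)
  have on: "orthonormal_set V g (insert n E)"
    unfolding orthonormal_set_def
  proof (intro conjI ballI)
    fix e e' assume "e \<in> insert n E" "e' \<in> insert n E"
    then show "g e e' = (if e = e' then 1 else 0)"
      using E nn en sym[OF nV] EV by (auto simp: orthonormal_set_def subset_iff)
  qed (use fin EV nV in auto)
  have "w = sqrt (g w w) *\<^sub>R n" using p by (simp add: n_def)
  then have "w \<in> span (insert n E)"
    by (metis insertI1 span_base span_scale)
  moreover have "s \<in> span (insert n E)" using s span_mono[of E "insert n E"] by blast
  ultimately have "v \<in> span (insert n E)"
    using span_add[of w _ s] by (fastforce simp: w_def)
  then have "insert v E \<subseteq> span (insert n E)"
    by (auto intro: span_base)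
  then have "span (insert v E) \<subseteq> span (insert n E)"
    by (simp add: span_minimal)
  then show ?thesis using that on by blast
qed

text \<open>This makes the finite-dimensional subspaces a directed set: with a basis of a second
  subspace as \<open>F\<close> it yields a common upper bound.\<close>

lemma orthonormal_union:
  assumes E: "orthonormal_set V g E" and "finite F" "F \<subseteq> V"
  obtains E' where "orthonormal_set V g E'" "span (E \<union> F) \<subseteq> span E'"
  using assms(2,3)
proof (induction F arbitrary: thesis rule: finite_induct)
  case empty
  then show ?case using E by auto
next
  case (insert v F)
  then obtain E1 where E1: "orthonormal_set V g E1" "span (E \<union> F) \<subseteq> span E1" by auto
  obtain E2 where E2: "orthonormal_set V g E2" "span (insert v E1) \<subseteq> span E2"
    using orthonormal_insert[OF E1(1), of v] insert.prems by auto
  have "E \<union> insert v F \<subseteq> span (insert v E1)"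
    using E1(2) span_superset[of "E \<union> F"] span_mono[of E1 "insert v E1"]
    by (auto intro: span_base)
  then have "span (E \<union> insert v F) \<subseteq> span E2"
    using E2(2) by (meson span_minimal subspace_span subset_trans)
  then show ?case using insert.prems(1) E2(1) by blast
qed

section \<open>Linear functionals and orthogonal projections on the algebraic dual\<close>

lemma form_in_top_dual: "\<xi> \<in> V \<Longrightarrow> (\<lambda>v\<in>V. g \<xi> v) \<in> top_dual V g"
  unfolding top_dual_def real_linear_on_def
  using Cauchy_Schwarz[of \<xi>] by (auto simp: add_right scale_right)

text \<open>Linearity of the points of \<open>hat V g\<close> is stated for functionals restricted
  to \<open>V\<close>, so the functional of the scaled vector has to be brought into that
  form.\<close>

lemma hat_form_scale:
  assumes "x \<in> hat V g" "\<xi> \<in> V"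
  shows "hat_form V g (c *\<^sub>R \<xi>) x = c * hat_form V g \<xi> x"
proof -
  define f where "f = (\<lambda>v\<in>V. g \<xi> v)"
  have "f \<in> top_dual V g" using assms form_in_top_dual by (simp add: f_def)
  moreover have "(\<lambda>v\<in>V. g (c *\<^sub>R \<xi>) v) = (\<lambda>v\<in>V. c * f v)"
    using assms by (auto simp: scale_left f_def)
  ultimately show ?thesis
    using assms(1) by (simp add: hat_form_def hat_def flip: f_def)
qed

lemma hat_form_add:
  assumes "x \<in> hat V g" "\<xi> \<in> V" "\<eta> \<in> V"
  shows "hat_form V g (\<xi> + \<eta>) x = hat_form V g \<xi> x + hat_form V g \<eta> x"
proof -
  define f where "f = (\<lambda>v\<in>V. g \<xi> v)"
  define f' where "f' = (\<lambda>v\<in>V. g \<eta> v)"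
  have "f \<in> top_dual V g" "f' \<in> top_dual V g"
    using assms form_in_top_dual by (auto simp: f_def f'_def)
  moreover have "(\<lambda>v\<in>V. g (\<xi> + \<eta>) v) = (\<lambda>v\<in>V. f v + f' v)"
    using assms by (auto simp: add_left f_def f'_def)
  ultimately show ?thesis
    using assms(1) by (simp add: hat_form_def hat_def flip: f_def f'_def)
qed

lemma hat_form_sum:
  assumes "x \<in> hat V g" "\<And>i. i \<in> I \<Longrightarrow> f i \<in> V"
  shows "hat_form V g (sum f I) x = (\<Sum>i\<in>I. hat_form V g (f i) x)"
  using assms(2)
proof (induction I rule: infinite_finite_induct)
  case (insert i I)
  then show ?case using assms(1) by (simp add: hat_form_add sum_in_V)
qed (use assms(1) hat_form_scale[of x 0 0] in auto)

lemma hat_proj_in: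
  assumes "orthonormal_set V g E"
  shows "hat_proj V g E x \<in> V"
  unfolding hat_proj_def using assms by (intro sum_in_V) (auto simp: orthonormal_set_def)

text \<open>The projection is symmetric and fixes \<open>span E\<close>: expanding \<open>u\<close>
  in the basis moves the coefficients into the linear map \<open>hat_form\<close>.\<close>

lemma form_hat_proj:
  assumes E: "orthonormal_set V g E" and u: "u \<in> V" "u \<in> span E" and x: "x \<in> hat V g"
  shows "g u (hat_proj V g E x) = hat_form V g u x"
proof -
  have EV: "E \<subseteq> V" using E by (auto simp: orthonormal_set_def)
  have "g u (hat_proj V g E x) = (\<Sum>e\<in>E. hat_form V g e x * g u e)"
    unfolding hat_proj_def using EV u by (subst sum_right) (auto simp: scale_right subset_iff)
  also have "\<dots> = (\<Sum>e\<in>E. hat_form V g (g e u *\<^sub>R e) x)"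
    using EV u x by (intro sum.cong) (auto simp: hat_form_scale sym[of u] subset_iff)
  also have "\<dots> = hat_form V g (\<Sum>e\<in>E. g e u *\<^sub>R e) x"
    using EV x by (subst hat_form_sum) auto
  also have "\<dots> = hat_form V g u x"
    using orthonormal_expansion[OF E u(2)] by simp
  finally show ?thesis .
qed

lemma hat_form_measurable:
  assumes "gaussian_measure V g c \<nu>" and "\<xi> \<in> V"
  shows "hat_form V g \<xi> \<in> borel_measurable \<nu>"
proof (rule measurableI)
  fix T :: "real set" assume T: "T \<in> sets borel"
  have "hat_form V g \<xi> -` T \<inter> space \<nu> = {x \<in> hat V g. x (\<lambda>v\<in>V. g \<xi> v) \<in> T}"
    using assms by (auto simp: gaussian_measure_def hat_form_def)
  also have "\<dots> \<in> sets \<nu>"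
    using assms form_in_top_dual[of \<xi>] T
    by (auto simp: gaussian_measure_def intro!: sigma_sets.Basic)
  finally show "hat_form V g \<xi> -` T \<inter> space \<nu> \<in> sets \<nu>" .
qed auto

text \<open>The characteristic functional at \<open>t *\<^sub>R \<xi>\<close> is the characteristic
  function at \<open>t\<close> of the law of one functional. Writing that law as a scaled standard
  normal law also covers variance zero, where there is no density.\<close>

lemma distr_hat_form:
  assumes G: "gaussian_measure V g c \<nu>" and c: "0 \<le> c" and \<xi>: "\<xi> \<in> V"
  shows "distr \<nu> borel (hat_form V g \<xi>) =
    distr std_normal_distribution borel (\<lambda>z. sqrt (c * g \<xi> \<xi>) * z)"
proof (rule Levy_uniqueness)
  interpret N: real_distribution std_normal_distribution by (rule real_dist_normal_dist)
  interpret P: prob_space \<nu> using G by (simp add: gaussian_measure_def)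
  note meas = hat_form_measurable[OF G \<xi>]
  show "real_distribution (distr \<nu> borel (hat_form V g \<xi>))"
    using meas by (rule P.real_distribution_distr)
  show "real_distribution (distr std_normal_distribution borel (\<lambda>z. sqrt (c * g \<xi> \<xi>) * z))"
    by (rule N.real_distribution_distr) simp
  show "char (distr \<nu> borel (hat_form V g \<xi>)) =
    char (distr std_normal_distribution borel (\<lambda>z. sqrt (c * g \<xi> \<xi>) * z))" (is "char ?M = char ?N")
  proof
    fix t :: real
    have "char ?M t = (\<integral>x. exp (\<i> * of_real (t * hat_form V g \<xi> x)) \<partial>\<nu>)"
      unfolding char_def using meas by (simp add: integral_distr)
    also have "\<dots> = (\<integral>x. exp (\<i> * of_real (hat_form V g (t *\<^sub>R \<xi>) x)) \<partial>\<nu>)"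
      using G \<xi> by (intro Bochner_Integration.integral_cong) (auto simp: gaussian_measure_def hat_form_scale)
    also have "\<dots> = of_real (exp (- c / 2 * g (t *\<^sub>R \<xi>) (t *\<^sub>R \<xi>)))"
      using G \<xi> unfolding gaussian_measure_def by simp
    also have "\<dots> = char std_normal_distribution (t * sqrt (c * g \<xi> \<xi>))"
      unfolding char_std_normal_distribution using \<xi> nonneg[OF \<xi>] c
      by (simp add: scale_left scale_right power_mult_distrib power2_eq_square[of t] mult_ac)
    also have "\<dots> = char ?N t"
      unfolding char_def by (simp add: integral_distr mult_ac)
    finally show "char ?M t = char ?N t" .
  qed
qed

end

lemma std_normal_exp:
  "integrable std_normal_distribution (\<lambda>z. exp (a * z))"
  "(\<integral>z. exp (a * z) \<partial>std_normal_distribution) = exp (a\<^sup>2 / 2)"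
proof -
  \<comment> \<open>Completing the square:
    \<open>a z - z^2 / 2 = a^2 / 2 - (z - a)^2 / 2\<close>.\<close>
  have eq: "std_normal_density z * exp (a * z) = exp (a\<^sup>2 / 2) * normal_density a 1 z" for z
    by (simp add: normal_density_def flip: exp_add) (simp add: field_simps power2_eq_square)
  show "integrable std_normal_distribution (\<lambda>z. exp (a * z))"
    by (simp add: integrable_density eq)
  show "(\<integral>z. exp (a * z) \<partial>std_normal_distribution) = exp (a\<^sup>2 / 2)"
    by (simp add: integral_density eq)
qed

text \<open>With the law known, this is the exponential moment of the standard normal law at
  \<open>a * sqrt (c * g \<xi> \<xi>)\<close>.\<close>

lemma (in inner_on) exp_hat_form:
  assumes G: "gaussian_measure V g c \<nu>" and c: "0 \<le> c" and \<xi>: "\<xi> \<in> V"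
  shows "integrable \<nu> (\<lambda>x. exp (a * hat_form V g \<xi> x))"
    and "(\<integral>x. exp (a * hat_form V g \<xi> x) \<partial>\<nu>) = exp (a\<^sup>2 * c * g \<xi> \<xi> / 2)"
proof -
  note meas = hat_form_measurable[OF G \<xi>]
  note D = distr_hat_form[OF G c \<xi>]
  have "integrable (distr \<nu> borel (hat_form V g \<xi>)) (\<lambda>y. exp (a * y))"
    unfolding D using std_normal_exp(1)[of "a * sqrt (c * g \<xi> \<xi>)"]
    by (simp add: integrable_distr_eq mult_ac)
  then show "integrable \<nu> (\<lambda>x. exp (a * hat_form V g \<xi> x))"
    using meas by (simp add: integrable_distr_eq)
  have "(\<integral>x. exp (a * hat_form V g \<xi> x) \<partial>\<nu>) = (\<integral>y. exp (a * y) \<partial>distr \<nu> borel (hat_form V g \<xi>))"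
    using meas by (simp add: integral_distr)
  also have "\<dots> = (\<integral>z. exp (a * sqrt (c * g \<xi> \<xi>) * z) \<partial>std_normal_distribution)"
    unfolding D by (simp add: integral_distr mult_ac)
  also have "\<dots> = exp (a\<^sup>2 * c * g \<xi> \<xi> / 2)"
    unfolding std_normal_exp using c nonneg[OF \<xi>] by (simp add: power_mult_distrib mult_ac)
  finally show "(\<integral>x. exp (a * hat_form V g \<xi> x) \<partial>\<nu>) = exp (a\<^sup>2 * c * g \<xi> \<xi> / 2)" .
qed

section \<open>Extension in probability from a Hilbert space to its algebraic dual\<close>

lemma extends_to_hat_cong:
  assumes V: "inner_on V g" and f: "\<And>v. v \<in> V \<Longrightarrow> f v = f' v"
  shows "extends_to_hat V g \<nu> f G \<longleftrightarrow> extends_to_hat V g \<nu> f' G"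
proof -
  interpret inner_on V g by fact
  have "f (hat_proj V g E x) = f' (hat_proj V g E x)" if "orthonormal_set V g E" for E x
    using f hat_proj_in[OF that] by blast
  then show ?thesis
    unfolding extends_to_hat_def by (simp cong: conj_cong)
qed

lemma extends_to_hatE:
  assumes ext: "extends_to_hat V g \<nu> f G" and "0 < \<epsilon>" "0 < \<delta>"
  obtains E0 where "orthonormal_set V g E0"
    and "\<And>E. \<lbrakk>orthonormal_set V g E; span E0 \<subseteq> span E\<rbrakk> \<Longrightarrow>
      (\<lambda>x. f (hat_proj V g E x)) \<in> borel_measurable \<nu>"
    and "\<And>E. \<lbrakk>orthonormal_set V g E; span E0 \<subseteq> span E\<rbrakk> \<Longrightarrow>
      measure \<nu> {x \<in> space \<nu>. \<epsilon> < cmod (f (hat_proj V g E x) - G x)} < \<delta>"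
proof -
  have "\<exists>E0. orthonormal_set V g E0 \<and> (\<forall>E. orthonormal_set V g E \<and> span E0 \<subseteq> span E \<longrightarrow>
      (\<lambda>x. f (hat_proj V g E x)) \<in> borel_measurable \<nu> \<and>
      measure \<nu> {x \<in> space \<nu>. \<epsilon> < cmod (f (hat_proj V g E x) - G x)} < \<delta>)"
    using ext[unfolded extends_to_hat_def, THEN conjunct2, rule_format, OF assms(2,3)] .
  then obtain E0 where E0: "orthonormal_set V g E0"
    "\<forall>E. orthonormal_set V g E \<and> span E0 \<subseteq> span E \<longrightarrow>
      (\<lambda>x. f (hat_proj V g E x)) \<in> borel_measurable \<nu> \<and>
      measure \<nu> {x \<in> space \<nu>. \<epsilon> < cmod (f (hat_proj V g E x) - G x)} < \<delta>"
    by (elim exE conjE)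
  show ?thesis
    by (rule that[OF E0(1)]) (use E0(2)[rule_format, OF conjI] in simp_all)
qed

lemma extends_to_hat_cmult:
  assumes ext: "extends_to_hat V g \<nu> f G"
  shows "extends_to_hat V g \<nu> (\<lambda>v. c * f v) (\<lambda>x. c * G x)"
proof (cases "c = 0")
  case True
  \<comment> \<open>For \<open>c = 0\<close> there is nothing to approximate, so the zero subspace
    serves as starting point.\<close>
  have "orthonormal_set V g {}" by (simp add: orthonormal_set_def)
  with True show ?thesis
    unfolding extends_to_hat_def by (intro conjI allI impI exI[of _ "{}"]) simp_all
next
  case False
  show ?thesis
    unfolding extends_to_hat_def
  proof (intro conjI allI impI)
    show "(\<lambda>x. c * G x) \<in> borel_measurable \<nu>" using ext by (auto simp: extends_to_hat_def)
    fix \<epsilon> \<delta> :: real assume "0 < \<epsilon>" "0 < \<delta>"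
    \<comment> \<open>Deviations are scaled by \<open>cmod c\<close>, so the tolerance is divided by
      it.\<close>
    then have "0 < \<epsilon> / cmod c" using False by simp
    obtain E0 where E0: "orthonormal_set V g E0"
      "\<And>E. orthonormal_set V g E \<Longrightarrow> span E0 \<subseteq> span E \<Longrightarrow>
          (\<lambda>x. f (hat_proj V g E x)) \<in> borel_measurable \<nu>"
      "\<And>E. orthonormal_set V g E \<Longrightarrow> span E0 \<subseteq> span E \<Longrightarrow>
           measure \<nu> {x \<in> space \<nu>. \<epsilon> / cmod c < cmod (f (hat_proj V g E x) - G x)} < \<delta>"
      by (fact extends_to_hatE[OF ext \<open>0 < \<epsilon> / cmod c\<close> \<open>0 < \<delta>\<close>])
    have "cmod (c * f y - c * G x) = cmod (f y - G x) * cmod c" for x y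
      by (simp add: norm_mult mult.commute flip: right_diff_distrib)
    then have eq: "\<epsilon> < cmod (c * f y - c * G x) \<longleftrightarrow> \<epsilon> / cmod c < cmod (f y - G x)" for x y
      using False by (simp add: pos_divide_less_eq)
    show "\<exists>E0. orthonormal_set V g E0 \<and> (\<forall>E. orthonormal_set V g E \<and> span E0 \<subseteq> span E \<longrightarrow>
           (\<lambda>x. c * f (hat_proj V g E x)) \<in> borel_measurable \<nu> \<and>
           measure \<nu> {x \<in> space \<nu>. \<epsilon> < cmod (c * f (hat_proj V g E x) - c * G x)} < \<delta>)"
      using E0 by (auto simp: eq intro!: exI[of _ E0])
  qed
qed

lemma extends_to_hat_cmult_iff:
  assumes "c \<noteq> 0"
  shows "extends_to_hat V g \<nu> (\<lambda>v. c * f v) G \<longleftrightarrow> extends_to_hat V g \<nu> f (\<lambda>x. G x / c)"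
proof
  assume "extends_to_hat V g \<nu> (\<lambda>v. c * f v) G"
  from extends_to_hat_cmult[OF this, of "1 / c"] assms
  show "extends_to_hat V g \<nu> f (\<lambda>x. G x / c)" by simp
next
  assume "extends_to_hat V g \<nu> f (\<lambda>x. G x / c)"
  from extends_to_hat_cmult[OF this, of c] assms
  show "extends_to_hat V g \<nu> (\<lambda>v. c * f v) G" by simp
qed

text \<open>Limits in probability along a directed set are unique: on a common upper bound of two
  starting subspaces, \<open>G\<close> and \<open>G'\<close> are both close to the same projected
  function off small sets. The tolerances \<open>1 / Suc n\<close> leave only countably many null
  sets to combine.\<close>

lemma extends_to_hat_unique:
  assumes V: "inner_on V g" and "prob_space \<nu>"
    and 1: "extends_to_hat V g \<nu> f G" and 2: "extends_to_hat V g \<nu> f G'"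
  shows "AE x in \<nu>. G x = G' x"
proof -
  interpret inner_on V g by fact
  interpret prob_space \<nu> by fact
  have [measurable]: "G \<in> borel_measurable \<nu>" "G' \<in> borel_measurable \<nu>"
    using 1 2 by (auto simp: extends_to_hat_def)
  have "AE x in \<nu>. cmod (G x - G' x) \<le> 1 / real (Suc n)" for n
  proof -
    \<comment> \<open>Half of the tolerance: if \<open>G\<close> and \<open>G'\<close> differ by
      more than \<open>2 * \<epsilon>\<close>, one of them is more than \<epsilon> away from the
      approximant.\<close>
    define \<epsilon> where "\<epsilon> = 1 / (2 * real (Suc n))"
    define A where "A = {x \<in> space \<nu>. 2 * \<epsilon> < cmod (G x - G' x)}"
    have A: "A \<in> events" unfolding A_def by measurable
    have "0 < \<epsilon>" by (simp add: \<epsilon>_def)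
    have small: "prob A \<le> 2 * \<delta>" if "0 < \<delta>" for \<delta>
    proof -
      obtain E1 where E1: "orthonormal_set V g E1"
        "\<And>E. orthonormal_set V g E \<Longrightarrow> span E1 \<subseteq> span E \<Longrightarrow>
          (\<lambda>x. f (hat_proj V g E x)) \<in> borel_measurable \<nu>"
        "\<And>E. orthonormal_set V g E \<Longrightarrow> span E1 \<subseteq> span E \<Longrightarrow>
           measure \<nu> {x \<in> space \<nu>. \<epsilon> < cmod (f (hat_proj V g E x) - G x)} < \<delta>"
        by (fact extends_to_hatE[OF 1 \<open>0 < \<epsilon>\<close> \<open>0 < \<delta>\<close>])
      obtain E2 where E2: "orthonormal_set V g E2"
        "\<And>E. orthonormal_set V g E \<Longrightarrow> span E2 \<subseteq> span E \<Longrightarrow>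
          (\<lambda>x. f (hat_proj V g E x)) \<in> borel_measurable \<nu>"
        "\<And>E. orthonormal_set V g E \<Longrightarrow> span E2 \<subseteq> span E \<Longrightarrow>
           measure \<nu> {x \<in> space \<nu>. \<epsilon> < cmod (f (hat_proj V g E x) - G' x)} < \<delta>"
        by (fact extends_to_hatE[OF 2 \<open>0 < \<epsilon>\<close> \<open>0 < \<delta>\<close>])
      obtain E where E: "orthonormal_set V g E" "span (E1 \<union> E2) \<subseteq> span E"
        using orthonormal_union[OF E1(1), of E2] E2(1) by (auto simp: orthonormal_set_def)
      have s: "span E1 \<subseteq> span E" "span E2 \<subseteq> span E"
        using E(2) span_mono[of E1 "E1 \<union> E2"] span_mono[of E2 "E1 \<union> E2"] by auto
      define B1 where "B1 = {x \<in> space \<nu>. \<epsilon> < cmod (f (hat_proj V g E x) - G x)}"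
      define B2 where "B2 = {x \<in> space \<nu>. \<epsilon> < cmod (f (hat_proj V g E x) - G' x)}"
      have [measurable]: "(\<lambda>x. f (hat_proj V g E x)) \<in> borel_measurable \<nu>"
        using E1(2)[OF E(1) s(1)] by blast
      have B: "B1 \<in> events" "B2 \<in> events" unfolding B1_def B2_def by measurable
      have "A \<subseteq> B1 \<union> B2"
      proof
        fix x assume x: "x \<in> A"
        have "cmod (G x - G' x) \<le>
            cmod (f (hat_proj V g E x) - G' x) + cmod (f (hat_proj V g E x) - G x)"
          using norm_triangle_ineq4[of "f (hat_proj V g E x) - G' x" "f (hat_proj V g E x) - G x"] by simp
        with x show "x \<in> B1 \<union> B2" by (auto simp: A_def B1_def B2_def)
      qed
      then have "prob A \<le> prob (B1 \<union> B2)" using B by (intro finite_measure_mono) auto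
      also have "\<dots> \<le> prob B1 + prob B2" using B by (rule measure_Un_le)
      also have "\<dots> \<le> 2 * \<delta>"
        using E1(3)[OF E(1) s(1)] E2(3)[OF E(1) s(2)] by (simp add: B1_def B2_def)
      finally show ?thesis .
    qed
    have "prob A = 0"
    proof (rule ccontr)
      assume "prob A \<noteq> 0"
      then have "0 < prob A" by (simp add: zero_less_measure_iff)
      \<comment> \<open>A quarter of \<open>prob A\<close> as \<delta> would give
        \<open>prob A \<le> prob A / 2\<close>.\<close>
      then show False using small[of "prob A / 4"] by simp
    qed
    then have "AE x in \<nu>. x \<notin> A" using A by (simp add: prob_eq_0)
    with AE_space show ?thesis by eventually_elim (auto simp: A_def \<epsilon>_def field_simps)
  qed
  then have "AE x in \<nu>. \<forall>n. cmod (G x - G' x) \<le> 1 / real (Suc n)"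
    by (simp add: AE_all_countable)
  then show ?thesis
  proof eventually_elim
    case (elim x)
    show ?case
    proof (rule ccontr)
      assume "G x \<noteq> G' x"
      then have "0 < cmod (G x - G' x)" by simp
      then obtain n where "1 / real (Suc n) < cmod (G x - G' x)"
        using nat_approx_posE by blast
      then show False using elim by (meson not_le)
    qed
  qed
qed

text \<open>Only one coordinate matters: once the subspace contains \<tau>, projecting changes
  nothing, and the exceptional set is empty rather than merely small.\<close>

lemma extends_to_hat_exp:
  assumes V: "inner_on V g" and G: "gaussian_measure V g c \<nu>" and \<tau>: "\<tau> \<in> V"
    and f: "\<And>v. v \<in> V \<Longrightarrow> f v = C * of_real (exp (a * g \<tau> v))"
  shows "extends_to_hat V g \<nu> f (\<lambda>x. C * of_real (exp (a * hat_form V g \<tau> x)))"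
proof -
  interpret inner_on V g by fact
  note meas = hat_form_measurable[OF G \<tau>]
  have meas': "(\<lambda>x. C * complex_of_real (exp (a * hat_form V g \<tau> x))) \<in> borel_measurable \<nu>"
    using meas by measurable
  have "orthonormal_set V g {}" by (simp add: orthonormal_set_def)
  then obtain E0 where E0: "orthonormal_set V g E0" "span {\<tau>} \<subseteq> span E0"
    using orthonormal_insert[of "{}" \<tau>] \<tau> by blast
  have eq: "f (hat_proj V g E x) = C * of_real (exp (a * hat_form V g \<tau> x))"
    if E: "orthonormal_set V g E" "span E0 \<subseteq> span E" and x: "x \<in> space \<nu>" for E x
  proof -
    have "\<tau> \<in> span E" using E(2) E0(2) by (meson span_base subsetD singletonI)
    then have "g \<tau> (hat_proj V g E x) = hat_form V g \<tau> x"
      using form_hat_proj[OF E(1) \<tau>] x G by (simp add: gaussian_measure_def)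
    then show ?thesis by (simp add: f hat_proj_in[OF E(1)])
  qed
  show ?thesis
    unfolding extends_to_hat_def
  proof (intro conjI allI impI exI[of _ E0])
    fix \<epsilon> \<delta> :: real and E
    assume "0 < \<epsilon>" "0 < \<delta>" and E: "orthonormal_set V g E \<and> span E0 \<subseteq> span E"
    show "(\<lambda>x. f (hat_proj V g E x)) \<in> borel_measurable \<nu>"
      using meas' E by (subst measurable_cong[where g = "\<lambda>x. C * of_real (exp (a * hat_form V g \<tau> x))"]) (auto simp: eq)
    have "{x \<in> space \<nu>. \<epsilon> < cmod (f (hat_proj V g E x) - C * of_real (exp (a * hat_form V g \<tau> x)))} = {}"
      using E \<open>0 < \<epsilon>\<close> by (auto simp: eq)
    then show "measure \<nu> {x \<in> space \<nu>. \<epsilon> < cmod (f (hat_proj V g E x) -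
        C * of_real (exp (a * hat_form V g \<tau> x)))} < \<delta>"
      using \<open>0 < \<delta>\<close> by (metis (no_types, lifting) measure_empty)
  qed (use meas' E0 in auto)
qed

section \<open>Amplitudes of coherent states\<close>

lemma aff_diff:
  assumes "affine_over A V t" "\<eta> \<in> A" "\<eta>' \<in> A"
  shows "aff_diff V t \<eta> \<eta>' \<in> V" and "t \<eta>' (aff_diff V t \<eta> \<eta>') = \<eta>"
proof -
  have "\<exists>!v. v \<in> V \<and> t \<eta>' v = \<eta>" using assms by (simp add: affine_over_def)
  from theI'[OF this] show "aff_diff V t \<eta> \<eta>' \<in> V" "t \<eta>' (aff_diff V t \<eta> \<eta>') = \<eta>"
    by (auto simp: aff_diff_def)
qed

lemma aff_diff_eq:
  assumes "affine_over A V t" "\<eta>' \<in> A" "v \<in> V" "t \<eta>' v = \<eta>"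
  shows "aff_diff V t \<eta> \<eta>' = v"
proof -
  have "\<eta> \<in> A" using assms by (auto simp: affine_over_def)
  then have "\<exists>!v. v \<in> V \<and> t \<eta>' v = \<eta>" using assms by (simp add: affine_over_def)
  then show ?thesis
    unfolding aff_diff_def using assms by (intro the1_equality) auto
qed

lemma inner_on_subset:
  assumes "inner_on V g" "subspace W" "W \<subseteq> V"
  shows "inner_on W g"
  using assms unfolding inner_on_def by (meson subsetD)

lemma real_linear_diff:
  assumes "subspace V" "real_linear_on V f" "u \<in> V" "v \<in> V"
  shows "f (u - v) = f u - f v"
proof -
  have "f (u + (-1) *\<^sub>R v) = f u + f ((-1) *\<^sub>R v)"
    using assms subspace_scale[OF assms(1), of v "-1"] unfolding real_linear_on_def by blast
  also have "f ((-1) *\<^sub>R v) = (-1) *\<^sub>R f v"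
    using assms unfolding real_linear_on_def by blast
  finally show ?thesis by simp
qed

lemma subspace_real_linear_image:
  assumes "subspace V" "real_linear_on V f"
  shows "subspace (f ` V)"
  unfolding subspace_def
proof (intro conjI ballI allI)
  have "f (0 *\<^sub>R 0) = 0 *\<^sub>R f 0"
    using assms subspace_0 unfolding real_linear_on_def by blast
  then show "0 \<in> f ` V" using subspace_0[OF assms(1)] by (metis imageI scale_zero_left)
next
  fix x y assume "x \<in> f ` V" "y \<in> f ` V"
  then obtain u v where "u \<in> V" "x = f u" "v \<in> V" "y = f v" by auto
  then show "x + y \<in> f ` V"
    using assms unfolding real_linear_on_def by (metis imageI subspace_add)
next
  fix c x assume "x \<in> f ` V"
  then obtain u where "u \<in> V" "x = f u" by auto
  then show "c *\<^sub>R x \<in> f ` V"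
    using assms unfolding real_linear_on_def by (metis imageI subspace_scale)
qed

text \<open>Inversion in each local homology group is an involution. Equality of the records also
  uses that orientations are extensional, because reversal produces a restricted function.\<close>

lemma hypersurface_rev_rev:
  assumes "hypersurface d S"
  shows "rev_hyp d (rev_hyp d S) = S"
proof -
  have ori: "orientation_on (int d - 1) (htop S) (hpts S) (hori S)"
    using assms by (simp add: hypersurface_def)
  have ext: "hori S \<in> extensional (hpts S)"
    using ori unfolding orientation_on_def by (rule conjunct1)
  have "inv\<^bsub>local_homology (int d - 1) (htop S) x\<^esub>
      (inv\<^bsub>local_homology (int d - 1) (htop S) x\<^esub> hori S x) = hori S x" if "x \<in> hpts S" for x
  proof (rule group.inv_inv)
    show "group (local_homology (int d - 1) (htop S) x)"
      by (simp add: local_homology_def)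
    show "hori S x \<in> carrier (local_homology (int d - 1) (htop S) x)"
      using ori that unfolding orientation_on_def by blast
  qed
  then have "(\<lambda>x\<in>hpts S. inv\<^bsub>local_homology (int d - 1) (htop S) x\<^esub>
      (\<lambda>x\<in>hpts S. inv\<^bsub>local_homology (int d - 1) (htop S) x\<^esub> hori S x) x) = hori S"
    by (intro extensionalityI[OF restrict_extensional ext]) simp
  then show ?thesis by (simp add: rev_hyp_def)
qed

section \<open>Consequences of the field theory axioms\<close>

locale affine_theory =
  fixes F :: "('p, 'a, 'l::real_vector, 'ar, 'lr::real_vector) field_theory"
    and d :: nat and X :: "'p spacetime"
  assumes system: "spacetime_system d X" and field: "affine_field_theory F d X"
begin

lemma C1: "axiom_C1 F X" and C2: "axiom_C2 F d X" and C3: "axiom_C3 F d X"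
  and copies: "copies_identified F X" and C4: "axiom_C4 F X" and C5: "axiom_C5 F X"
  and C6: "axiom_C6 F d X" and C7: "axiom_C7 F d X"
  using field by (simp_all add: affine_field_theory_def)

lemma rbd_in: "M \<in> Regs X \<Longrightarrow> rbd M \<in> Hyps X"
  and rev_in: "S \<in> Hyps X \<Longrightarrow> rev_hyp d S \<in> Hyps X"
  and hypersurfaceI: "S \<in> Hyps X \<Longrightarrow> hypersurface d S"
  and copy_in: "(S, S', f) \<in> Copies X \<Longrightarrow> S \<in> Hyps X \<and> S' \<in> Hyps X"
  and gluing_in: "gl \<in> Gluings X \<Longrightarrow>
    gM gl \<in> Regs X \<and> gM1 gl \<in> Regs X \<and> ghcopy gl \<in> Copies X \<and> gluing d gl"
  using system by (auto simp: spacetime_system_def)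

lemma rev_rev: "S \<in> Hyps X \<Longrightarrow> rev_hyp d (rev_hyp d S) = S"
  by (simp add: hypersurfaceI hypersurface_rev_rev)

lemma Hilbert: "S \<in> Hyps X \<Longrightarrow> complex_separable_Hilbert F S"
  and affine: "S \<in> Hyps X \<Longrightarrow> affine_over (Aff F S) (Lin F S) (plus_aff F S)"
  using C1 by (auto simp: axiom_C1_def)

lemma inner_Lin:
  assumes "S \<in> Hyps X"
  shows "inner_on (Lin F S) (gform F S)"
proof -
  have H: "\<And>u v. \<lbrakk>u \<in> Lin F S; v \<in> Lin F S\<rbrakk> \<Longrightarrow> herm F S v u = cnj (herm F S u v)"
    "\<And>u v z. \<lbrakk>u \<in> Lin F S; v \<in> Lin F S\<rbrakk> \<Longrightarrow> herm F S u (cscale F S z v) = z * herm F S u v"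
    "\<And>u v w. \<lbrakk>u \<in> Lin F S; v \<in> Lin F S; w \<in> Lin F S\<rbrakk> \<Longrightarrow>
      herm F S u (v + w) = herm F S u v + herm F S u w"
    "\<And>v r. v \<in> Lin F S \<Longrightarrow> cscale F S (of_real r) v = r *\<^sub>R v"
    "\<And>u. \<lbrakk>u \<in> Lin F S; u \<noteq> 0\<rbrakk> \<Longrightarrow> 0 < Re (herm F S u u)"
    "subspace (Lin F S)"
    using Hilbert[OF assms] unfolding complex_separable_Hilbert_def by blast+
  show ?thesis
  proof
    fix u v c assume uv: "u \<in> Lin F S" "v \<in> Lin F S"
    show "gform F S u v = gform F S v u"
      using H(1)[OF uv] by (simp add: gform_def)
    show "gform F S u (c *\<^sub>R v) = c * gform F S u v"
      using H(2)[OF uv, of "of_real c"] H(4)[OF uv(2), of c] by (simp add: gform_def)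
  qed (use H(3,5,6) in \<open>auto simp: gform_def\<close>)
qed

lemma plus_in: "\<lbrakk>S \<in> Hyps X; \<eta> \<in> Aff F S; v \<in> Lin F S\<rbrakk> \<Longrightarrow> plus_aff F S \<eta> v \<in> Aff F S"
  and plus_plus: "\<lbrakk>S \<in> Hyps X; \<eta> \<in> Aff F S; u \<in> Lin F S; v \<in> Lin F S\<rbrakk> \<Longrightarrow>
    plus_aff F S (plus_aff F S \<eta> u) v = plus_aff F S \<eta> (u + v)"
  using affine[of S] by (simp_all add: affine_over_def)

lemma diffA_in: "\<lbrakk>S \<in> Hyps X; \<eta> \<in> Aff F S; \<eta>' \<in> Aff F S\<rbrakk> \<Longrightarrow> diffA F S \<eta> \<eta>' \<in> Lin F S"
  and plus_diffA: "\<lbrakk>S \<in> Hyps X; \<eta> \<in> Aff F S; \<eta>' \<in> Aff F S\<rbrakk> \<Longrightarrow>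
    plus_aff F S \<eta>' (diffA F S \<eta> \<eta>') = \<eta>"
  using aff_diff[OF affine[of S], of \<eta> \<eta>'] by (simp_all add: diffA_def)

lemma diffA_eq:
  "\<lbrakk>S \<in> Hyps X; \<eta> \<in> Aff F S; v \<in> Lin F S; plus_aff F S \<eta> v = \<eta>'\<rbrakk> \<Longrightarrow> diffA F S \<eta>' \<eta> = v"
  using aff_diff_eq[OF affine[of S]] by (simp add: diffA_def)

lemma theta_plus: "\<lbrakk>S \<in> Hyps X; \<eta> \<in> Aff F S; u \<in> Lin F S; v \<in> Lin F S\<rbrakk> \<Longrightarrow>
    theta F S (plus_aff F S \<eta> u) v = brak F S u v + theta F S \<eta> v"
  and Im_herm: "\<lbrakk>S \<in> Hyps X; u \<in> Lin F S; v \<in> Lin F S\<rbrakk> \<Longrightarrow>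
    Im (herm F S u v) = brak F S u v - brak F S v u"
  using C1 by (auto simp: axiom_C1_def omega_def)

lemma theta_linear: "\<lbrakk>S \<in> Hyps X; \<eta> \<in> Aff F S\<rbrakk> \<Longrightarrow> real_linear_on (Lin F S) (theta F S \<eta>)"
  using C1 by (auto simp: axiom_C1_def)

text \<open>In the quotient the terms quadratic in \<open>v\<close> cancel. The antisymmetric part
  of the bracket supplies the imaginary part of \<open>herm F S \<tau> v\<close> and the cross term
  of the metric its real part, so \<open>v\<close> enters only through a complex linear
  form.\<close>

lemma chi_coherent:
  assumes S: "S \<in> Hyps X" and \<eta>: "\<eta> \<in> Aff F S" and \<tau>: "\<tau> \<in> Lin F S" and v: "v \<in> Lin F S"
  defines "\<zeta> \<equiv> plus_aff F S \<eta> \<tau>"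
  shows "chi F S \<eta> (coherent F S \<zeta>) v =
    exp (- \<i> / 2 * of_real (theta F S \<eta> \<tau> + theta F S \<zeta> \<tau>)) *
    of_real (exp (- gform F S \<tau> \<tau> / 4)) * exp (herm F S \<tau> v / 2)"
proof -
  interpret inner_on "Lin F S" "gform F S" using S by (rule inner_Lin)
  define \<phi> where "\<phi> = plus_aff F S \<eta> v"
  have \<zeta>: "\<zeta> \<in> Aff F S" and \<phi>: "\<phi> \<in> Aff F S"
    using plus_in S \<eta> \<tau> v by (auto simp: \<zeta>_def \<phi>_def)
  have d1: "diffA F S \<phi> \<eta> = v"
    using diffA_eq[OF S \<eta> v] by (simp add: \<phi>_def)
  have d2: "diffA F S \<phi> \<zeta> = v - \<tau>"
    using S \<zeta> \<eta> \<tau> v by (intro diffA_eq) (auto simp: \<zeta>_def \<phi>_def plus_plus)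
  note lin = real_linear_diff[OF subspace theta_linear[OF S]]
  have a1: "theta F S \<zeta> (v - \<tau>) =
      brak F S \<tau> v + theta F S \<eta> v - theta F S \<zeta> \<tau>"
    using lin[OF \<zeta> v \<tau>] theta_plus[OF S \<eta> \<tau> v] by (simp add: \<zeta>_def)
  have a2: "theta F S \<phi> (v - \<tau>) = theta F S \<phi> v - brak F S v \<tau> - theta F S \<eta> \<tau>"
    using lin[OF \<phi> v \<tau>] theta_plus[OF S \<eta> v \<tau>] by (simp add: \<phi>_def)
  have a3: "gform F S (v - \<tau>) (v - \<tau>) =
      gform F S v v - 2 * Re (herm F S \<tau> v) + gform F S \<tau> \<tau>"
    using v \<tau> sym[OF v \<tau>] by (simp add: diff_left diff_right gform_def[of F S \<tau> v])
  have "chi F S \<eta> (coherent F S \<zeta>) v =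
      exp ((\<i> / 2 * of_real (theta F S \<zeta> (v - \<tau>)) + \<i> / 2 * of_real (theta F S \<phi> (v - \<tau>))
        - of_real (gform F S (v - \<tau>) (v - \<tau>) / 4))
      - (\<i> / 2 * of_real (theta F S \<eta> v) + \<i> / 2 * of_real (theta F S \<phi> v)
        - of_real (gform F S v v / 4)))"
    using \<phi> by (simp add: chi_def coherent_def alpha_def d1 d2 exp_diff flip: \<phi>_def)
  also have "\<dots> = exp (- \<i> / 2 * of_real (theta F S \<eta> \<tau> + theta F S \<zeta> \<tau>) +
      of_real (- gform F S \<tau> \<tau> / 4) + herm F S \<tau> v / 2)"
    unfolding a1 a2 a3 using Im_herm[OF S \<tau> v]
    by (intro arg_cong[where f = exp] complex_eqI) (simp_all add: field_simps)
  finally show ?thesis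
    by (simp only: exp_add exp_of_real)
qed

text \<open>With its own label \<zeta> as base point a coherent state has constant holomorphic part
  1, a cylinder function of zero variables, and membership asks for one base point.\<close>

lemma coherent_in_state_space:
  assumes S: "S \<in> Hyps X" and \<zeta>: "\<zeta> \<in> Aff F S"
    and G: "gaussian_measure (Lin F S) (gform F S) 1 (\<nu> S)"
  shows "coherent F S \<zeta> \<in> state_space F \<nu> S"
proof -
  interpret prob_space "\<nu> S" using G by (simp add: gaussian_measure_def)
  have chi: "chi F S \<zeta> (coherent F S \<zeta>) v = 1" if "v \<in> Lin F S" for v
    using plus_in[OF S \<zeta> that] by (simp add: chi_def coherent_def alpha_def)
  have "holomorphic_cylinder F S (\<lambda>x. 1)"
    unfolding holomorphic_cylinder_def
    by (intro exI[of _ 0] exI[of _ "\<lambda>_. 0"] exI[of _ "\<lambda>_. 1"]) (simp add: entire_function_def)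
  then have "square_integrable_holomorphic F \<nu> S (chi F S \<zeta> (coherent F S \<zeta>)) (\<lambda>x. 1)"
    unfolding square_integrable_holomorphic_def using chi
    by (intro conjI exI[of _ "\<lambda>_ _. 1"]) auto
  then show ?thesis
    using \<zeta> by (auto simp: state_space_def coherent_def)
qed

lemma subspace_Lin_tilde:
  assumes "M \<in> Regs X"
  shows "subspace (Lin_tilde F M)"
proof -
  have "subspace (LinR F M)" using C4 assms unfolding axiom_C4_def by blast
  moreover have "real_linear_on (LinR F M) (bdL F M)" using C5 assms unfolding axiom_C5_def by blast
  ultimately show ?thesis unfolding Lin_tilde_def by (rule subspace_real_linear_image)
qed

lemma Lin_tilde_subset: "M \<in> Regs X \<Longrightarrow> Lin_tilde F M \<subseteq> Lin F (rbd M)"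
  using C5 unfolding axiom_C5_def Lin_tilde_def by blast

lemma inner_Lin_tilde: "M \<in> Regs X \<Longrightarrow> inner_on (Lin_tilde F M) (gform F (rbd M))"
  by (meson inner_on_subset inner_Lin rbd_in subspace_Lin_tilde Lin_tilde_subset)

lemma bdA_in: "\<lbrakk>M \<in> Regs X; \<eta> \<in> AffR F M\<rbrakk> \<Longrightarrow> bdA F M \<eta> \<in> Aff F (rbd M)"
  using C5 unfolding axiom_C5_def by blast

text \<open>Isotropy, one inclusion of the Lagrangian condition; it makes \<open>herm\<close> real
  on \<open>Lin_tilde F M\<close>.\<close>

lemma omega_Lin_tilde:
  assumes "M \<in> Regs X" "u \<in> Lin_tilde F M" "v \<in> Lin_tilde F M"
  shows "omega F (rbd M) u v = 0"
proof -
  have "Lin_tilde F M = {u \<in> Lin F (rbd M). \<forall>v\<in>Lin_tilde F M. omega F (rbd M) u v = 0}"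
    using C5 assms(1) unfolding axiom_C5_def by blast
  then show ?thesis using assms by blast
qed

text \<open>By \<open>axiom_C5\<close> the action is constant on each fibre of
  \<open>bdA F M\<close>, so the description has a unique value.\<close>

lemma action_tilde_eq:
  assumes "M \<in> Regs X" "\<zeta> \<in> AffR F M"
  shows "action_tilde F M (bdA F M \<zeta>) = action F M \<zeta>"
  unfolding action_tilde_def
proof (rule the_equality)
  show "\<exists>\<zeta>'\<in>AffR F M. bdA F M \<zeta>' = bdA F M \<zeta> \<and> action F M \<zeta>' = action F M \<zeta>"
    using assms by blast
next
  fix s assume "\<exists>\<zeta>'\<in>AffR F M. bdA F M \<zeta>' = bdA F M \<zeta> \<and> action F M \<zeta>' = s"
  moreover have "action F M \<zeta>' = action F M \<zeta>"
    if "\<zeta>' \<in> AffR F M" "bdA F M \<zeta>' = bdA F M \<zeta>" for \<zeta>'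
    using C5 assms that unfolding axiom_C5_def by blast
  ultimately show "s = action F M \<zeta>" by blast
qed

text \<open>The difference is formed inside the region and then mapped by \<open>bdL F M\<close>;
  this is what places \<tau> in \<open>Lin_tilde F M\<close> and not merely in the boundary
  space.\<close>

lemma action_difference:
  assumes M: "M \<in> Regs X" and \<eta>: "\<eta> \<in> AffR F M" and \<zeta>: "\<zeta> \<in> AffR F M"
  obtains \<tau> where "\<tau> \<in> Lin_tilde F M" "bdA F M \<zeta> = plus_aff F (rbd M) (bdA F M \<eta>) \<tau>"
    "action F M \<zeta> = action F M \<eta> -
      (theta F (rbd M) (bdA F M \<eta>) \<tau> + theta F (rbd M) (bdA F M \<zeta>) \<tau>) / 2"
proof -
  have aff: "affine_over (AffR F M) (LinR F M) (plus_affR F M)"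
    using C4 M by (auto simp: axiom_C4_def)
  define \<sigma> where "\<sigma> = diffAR F M \<zeta> \<eta>"
  have \<sigma>: "\<sigma> \<in> LinR F M" "plus_affR F M \<eta> \<sigma> = \<zeta>"
    using aff_diff[OF aff \<zeta> \<eta>] by (auto simp: \<sigma>_def diffAR_def)
  have plus: "bdA F M (plus_affR F M \<eta> \<sigma>) = plus_aff F (rbd M) (bdA F M \<eta>) (bdL F M \<sigma>)"
    using C5 M \<eta> \<sigma>(1) unfolding axiom_C5_def by blast
  have act: "action F M \<zeta> = action F M \<eta> -
      theta F (rbd M) (bdA F M \<zeta>) (bdL F M \<sigma>) / 2 - theta F (rbd M) (bdA F M \<eta>) (bdL F M \<sigma>) / 2"
    using C5 M \<eta> \<zeta> unfolding axiom_C5_def \<sigma>_def by blast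
  show ?thesis
  proof (rule that[of "bdL F M \<sigma>"])
    show "bdL F M \<sigma> \<in> Lin_tilde F M" using \<sigma>(1) by (simp add: Lin_tilde_def)
  qed (use plus act \<sigma>(2) in \<open>simp_all add: field_simps\<close>)
qed

end

section \<open>Amplitudes as Gaussian integrals\<close>

locale gaussian_theory = affine_theory F d X
  for F :: "('p, 'a, 'l::real_vector, 'ar, 'lr::real_vector) field_theory"
    and d :: nat and X :: "'p spacetime" +
  fixes \<nu> :: "'p hyp \<Rightarrow> (('l \<Rightarrow> real) \<Rightarrow> real) measure"
    and \<nu>t :: "'p region \<Rightarrow> (('l \<Rightarrow> real) \<Rightarrow> real) measure"
  assumes gaussian: "gaussian_measures F \<nu> \<nu>t X"
begin

lemma gaussian_Lin: "S \<in> Hyps X \<Longrightarrow> gaussian_measure (Lin F S) (gform F S) 1 (\<nu> S)"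
  and gaussian_Lin_tilde:
    "M \<in> Regs X \<Longrightarrow> gaussian_measure (Lin_tilde F M) (gform F (rbd M)) 2 (\<nu>t M)"
  using gaussian by (auto simp: gaussian_measures_def)

text \<open>The relation demands its integral formula at every base point \<eta>, so the integral is
  evaluated for arbitrary \<eta> and shown to give the same value each time.\<close>

lemma has_amplitude_coherent:
  assumes M: "M \<in> Regs X" and \<zeta>: "\<zeta> \<in> AffR F M"
  shows "has_amplitude F \<nu> \<nu>t M (coherent F (rbd M) (bdA F M \<zeta>)) (exp (\<i> * of_real (action F M \<zeta>)))"
  unfolding has_amplitude_def
proof (intro conjI ballI)
  note S = rbd_in[OF M]
  show "coherent F (rbd M) (bdA F M \<zeta>) \<in> state_space F \<nu> (rbd M)"
    using coherent_in_state_space[OF S] bdA_in[OF M \<zeta>] gaussian_Lin[OF S] by blast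
  fix \<eta> assume \<eta>: "\<eta> \<in> AffR F M"
  let ?g = "gform F (rbd M)" and ?V = "Lin_tilde F M"
  interpret inner_on ?V ?g using M by (rule inner_Lin_tilde)
  note G = gaussian_Lin_tilde[OF M]
  obtain \<tau> where \<tau>: "\<tau> \<in> ?V" and \<zeta>\<tau>: "bdA F M \<zeta> = plus_aff F (rbd M) (bdA F M \<eta>) \<tau>"
    and act: "action F M \<zeta> = action F M \<eta> -
      (theta F (rbd M) (bdA F M \<eta>) \<tau> + theta F (rbd M) (bdA F M \<zeta>) \<tau>) / 2"
    using action_difference[OF M \<eta> \<zeta>] by blast
  define \<theta> where "\<theta> = theta F (rbd M) (bdA F M \<eta>) \<tau> + theta F (rbd M) (bdA F M \<zeta>) \<tau>"
  define C where "C = exp (- \<i> / 2 * of_real \<theta>) * of_real (exp (- ?g \<tau> \<tau> / 4))"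
  have chi: "chi F (rbd M) (bdA F M \<eta>) (coherent F (rbd M) (bdA F M \<zeta>)) v =
      C * of_real (exp (1 / 2 * ?g \<tau> v))" if v: "v \<in> ?V" for v
  proof -
    \<comment> \<open>Isotropy removes the imaginary part.\<close>
    have "herm F (rbd M) \<tau> v / 2 = of_real (1 / 2 * ?g \<tau> v)"
      using omega_Lin_tilde[OF M \<tau> v] by (simp add: complex_eq_iff gform_def omega_def)
    then show ?thesis
      using chi_coherent[OF S bdA_in[OF M \<eta>], of \<tau> v] Lin_tilde_subset[OF M] \<tau> v
      by (simp only: C_def \<theta>_def \<zeta>\<tau> exp_of_real subsetD)
  qed
  let ?G = "\<lambda>x. C * complex_of_real (exp (1 / 2 * hat_form ?V ?g \<tau> x))"
  have int: "integrable (\<nu>t M) ?G"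
    using exp_hat_form(1)[OF G _ \<tau>, of "1 / 2"] by (intro integrable_mult_right integrable_of_real) simp
  have "(\<integral>x. ?G x \<partial>\<nu>t M) = C * of_real (\<integral>x. exp (1 / 2 * hat_form ?V ?g \<tau> x) \<partial>\<nu>t M)"
    by (simp only: integral_mult_right_zero integral_complex_of_real)
  \<comment> \<open>The exponent is \<open>a^2 * c / 2\<close> with \<open>a = 1 / 2\<close> and
    covariance factor \<open>c = 2\<close>; it cancels the real factor contained in
    \<open>C\<close>.\<close>
  also have "\<dots> = C * of_real (exp (?g \<tau> \<tau> / 4))"
    using exp_hat_form(2)[OF G _ \<tau>, of "1 / 2"] by (simp add: power2_eq_square)
  also have "\<dots> = exp (- \<i> / 2 * of_real \<theta>)"
    by (simp add: C_def mult.assoc flip: of_real_mult exp_add)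
  finally have "exp (\<i> * of_real (action F M \<eta>)) * (\<integral>x. ?G x \<partial>\<nu>t M) =
      exp (\<i> * of_real (action F M \<zeta>))"
    by (simp add: act algebra_simps flip: exp_add \<theta>_def)
  then show "\<exists>G. extends_to_hat ?V ?g (\<nu>t M)
        (chi F (rbd M) (bdA F M \<eta>) (coherent F (rbd M) (bdA F M \<zeta>))) G \<and>
      integrable (\<nu>t M) G \<and>
      exp (\<i> * of_real (action F M \<zeta>)) = exp (\<i> * of_real (action F M \<eta>)) * (\<integral>x. G x \<partial>\<nu>t M)"
    using extends_to_hat_exp[OF inner_Lin_tilde[OF M] G \<tau> chi] int by metis
qed

text \<open>At one base point, which exists since \<open>AffR F M\<close> is nonempty, both values
  are integrals of extensions of the same function, and these agree almost everywhere.\<close>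

lemma has_amplitude_unique:
  assumes M: "M \<in> Regs X" and 1: "has_amplitude F \<nu> \<nu>t M \<psi> z" and 2: "has_amplitude F \<nu> \<nu>t M \<psi> z'"
  shows "z = z'"
proof -
  obtain \<eta> where \<eta>: "\<eta> \<in> AffR F M"
    using C4 M unfolding axiom_C4_def affine_over_def by blast
  let ?ext = "extends_to_hat (Lin_tilde F M) (gform F (rbd M)) (\<nu>t M) (chi F (rbd M) (bdA F M \<eta>) \<psi>)"
  obtain G where G: "?ext G" "integrable (\<nu>t M) G"
    "z = exp (\<i> * of_real (action F M \<eta>)) * (\<integral>x. G x \<partial>\<nu>t M)"
    using 1 \<eta> unfolding has_amplitude_def by blast
  obtain G' where G': "?ext G'" "integrable (\<nu>t M) G'"
    "z' = exp (\<i> * of_real (action F M \<eta>)) * (\<integral>x. G' x \<partial>\<nu>t M)"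
    using 2 \<eta> unfolding has_amplitude_def by blast
  have "prob_space (\<nu>t M)" using gaussian_Lin_tilde[OF M] by (simp add: gaussian_measure_def)
  from extends_to_hat_unique[OF inner_Lin_tilde[OF M] this G(1) G'(1)]
  have "(\<integral>x. G x \<partial>\<nu>t M) = (\<integral>x. G' x \<partial>\<nu>t M)"
    using G(2) G'(2) by (intro integral_cong_AE) auto
  then show ?thesis using G(3) G'(3) by simp
qed

lemma amplitude_eq:
  "\<lbrakk>M \<in> Regs X; has_amplitude F \<nu> \<nu>t M \<psi> z\<rbrakk> \<Longrightarrow> amplitude F \<nu> \<nu>t M \<psi> = z"
  unfolding amplitude_def using has_amplitude_unique by (blast intro: the_equality)

lemma amplitude_coherent:
  assumes "M \<in> Regs X" "\<eta> \<in> Aff_tilde F M"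
  shows "amplitude_defined F \<nu> \<nu>t M (coherent F (rbd M) \<eta>)"
    and "amplitude F \<nu> \<nu>t M (coherent F (rbd M) \<eta>) = exp (\<i> * of_real (action_tilde F M \<eta>))"
proof -
  obtain \<zeta> where \<zeta>: "\<zeta> \<in> AffR F M" "\<eta> = bdA F M \<zeta>"
    using assms(2) by (auto simp: Aff_tilde_def)
  note h = has_amplitude_coherent[OF assms(1) \<zeta>(1)]
  show "amplitude_defined F \<nu> \<nu>t M (coherent F (rbd M) \<eta>)"
    using h \<zeta>(2) by (auto simp: amplitude_defined_def)
  show "amplitude F \<nu> \<nu>t M (coherent F (rbd M) \<eta>) = exp (\<i> * of_real (action_tilde F M \<eta>))"
    using amplitude_eq[OF assms(1) h] by (simp add: \<zeta>(2) action_tilde_eq[OF assms(1) \<zeta>(1)])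
qed

end

section \<open>Coherent states under reversal and disjoint union\<close>

context affine_theory
begin

lemma
  assumes S: "S \<in> Hyps X"
  shows revL_in: "v \<in> Lin F S \<Longrightarrow> revL F S v \<in> Lin F (rev_hyp d S)"
    and revL_revL: "v \<in> Lin F S \<Longrightarrow> revL F (rev_hyp d S) (revL F S v) = v"
    and revA_revA: "\<eta> \<in> Aff F S \<Longrightarrow> revA F (rev_hyp d S) (revA F S \<eta>) = \<eta>"
    and revA_plus: "\<lbrakk>\<eta> \<in> Aff F S; v \<in> Lin F S\<rbrakk> \<Longrightarrow>
      revA F S (plus_aff F S \<eta> v) = plus_aff F (rev_hyp d S) (revA F S \<eta>) (revL F S v)"
    and theta_rev: "\<lbrakk>\<eta> \<in> Aff F S; v \<in> Lin F S\<rbrakk> \<Longrightarrow>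
      theta F (rev_hyp d S) (revA F S \<eta>) (revL F S v) = - theta F S \<eta> v"
    and herm_rev: "\<lbrakk>u \<in> Lin F S; v \<in> Lin F S\<rbrakk> \<Longrightarrow>
      herm F (rev_hyp d S) (revL F S u) (revL F S v) = cnj (herm F S u v)"
  using bspec[OF C2[unfolded axiom_C2_def Let_def] S] by blast+

text \<open>A homeomorphism between the spaces \<open>topA\<close> says nothing about their points here:
  \<open>Metric_space.mtopology\<close> unfolds only for a distance that is symmetric on the whole type, and
  \<open>herm\<close> is arbitrary outside \<open>Lin\<close>.  That \<open>revA\<close> and \<open>prjA\<close> map \<open>Aff\<close> to \<open>Aff\<close> is therefore
  derived from a single point, for which it is an assumption.\<close>

lemma coherent_rev:
  assumes S: "S \<in> Hyps X" and \<zeta>: "\<zeta> \<in> Aff F S" and r\<zeta>: "revA F S \<zeta> \<in> Aff F (rev_hyp d S)"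
  shows "coherent F (rev_hyp d S) (revA F S \<zeta>) = iota F d S (coherent F S \<zeta>)"
proof
  fix \<phi>
  let ?R = "rev_hyp d S"
  have R: "?R \<in> Hyps X" using S by (rule rev_in)
  show "coherent F ?R (revA F S \<zeta>) \<phi> = iota F d S (coherent F S \<zeta>) \<phi>"
  proof (cases "\<phi> \<in> Aff F ?R")
    case False
    then show ?thesis by (simp add: coherent_def iota_def)
  next
    case True
    define w where "w = diffA F ?R \<phi> (revA F S \<zeta>)"
    have w: "w \<in> Lin F ?R" "plus_aff F ?R (revA F S \<zeta>) w = \<phi>"
      using diffA_in[OF R True r\<zeta>] plus_diffA[OF R True r\<zeta>] by (simp_all add: w_def)
    \<comment> \<open>Pulling \<open>w\<close> back lands in \<open>Lin F S\<close> because the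
      reverse of the reverse is \<open>S\<close> itself.\<close>
    define v where "v = revL F ?R w"
    have v: "v \<in> Lin F S" "revL F S v = w"
      using revL_in[OF R w(1)] revL_revL[OF R w(1)] by (simp_all add: v_def rev_rev S)
    define \<eta> where "\<eta> = plus_aff F S \<zeta> v"
    have \<eta>: "\<eta> \<in> Aff F S" unfolding \<eta>_def by (rule plus_in[OF S \<zeta> v(1)])
    have r\<eta>: "revA F S \<eta> = \<phi>"
      using revA_plus[OF S \<zeta> v(1)] v(2) w(2) by (simp add: \<eta>_def)
    have d: "diffA F S \<eta> \<zeta> = v" by (rule diffA_eq[OF S \<zeta> v(1)]) (simp add: \<eta>_def)
    have "theta F ?R (revA F S \<zeta>) w = - theta F S \<zeta> v" "theta F ?R \<phi> w = - theta F S \<eta> v"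
      using theta_rev[OF S \<zeta> v(1)] theta_rev[OF S \<eta> v(1)] v(2) r\<eta> by simp_all
    moreover have "gform F ?R w w = gform F S v v"
      using herm_rev[OF S v(1) v(1)] v(2) by (simp add: gform_def)
    ultimately show ?thesis
      using True \<eta> revA_revA[OF S \<eta>] r\<eta> d
      by (simp add: coherent_def iota_def exp_cnj flip: w_def)
  qed
qed

text \<open>The exponent is built from \<open>theta\<close> and \<open>gform\<close>, which are sums
  over the parts by \<open>axiom_C3\<close>, and exponentials of sums are products. The projections
  of any other point lie in the right affine spaces because they are translates of those of
  \<zeta>.\<close>

lemma coherent_tensor:
  assumes S: "S \<in> Hyps X" and Ss: "set Ss \<subseteq> Hyps X" and U: "disj_union_hyp d S Ss"
    and \<zeta>: "\<zeta> \<in> Aff F S" and p\<zeta>: "\<And>S'. S' \<in> set Ss \<Longrightarrow> prjA F S S' \<zeta> \<in> Aff F S'"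
  shows "coherent F S \<zeta> = tensor F S Ss (map (\<lambda>S'. coherent F S' (prjA F S S' \<zeta>)) Ss)"
proof
  fix \<phi>
  note c3 = C3[unfolded axiom_C3_def, THEN conjunct1, THEN bspec, OF S, THEN spec, THEN mp,
      OF conjI[OF Ss U]]
  show "coherent F S \<zeta> \<phi> = tensor F S Ss (map (\<lambda>S'. coherent F S' (prjA F S S' \<zeta>)) Ss) \<phi>"
  proof (cases "\<phi> \<in> Aff F S")
    case False
    then show ?thesis by (simp add: coherent_def tensor_def)
  next
    case \<phi>: True
    define v where "v = diffA F S \<phi> \<zeta>"
    have v: "v \<in> Lin F S" "plus_aff F S \<zeta> v = \<phi>"
      using diffA_in[OF S \<phi> \<zeta>] plus_diffA[OF S \<phi> \<zeta>] by (simp_all add: v_def)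
    have pv: "prjL F S (Ss ! i) v \<in> Lin F (Ss ! i)" if "i < length Ss" for i
    proof -
      have "bij_betw (\<lambda>\<phi>. \<lambda>i\<in>{..<length Ss}. prjL F S (Ss ! i) \<phi>) (Lin F S)
         (PiE {..<length Ss} (\<lambda>i. Lin F (Ss ! i)))"
        using c3 by blast
      from bij_betwE[OF this] v(1)
      have "(\<lambda>i\<in>{..<length Ss}. prjL F S (Ss ! i) v) \<in> PiE {..<length Ss} (\<lambda>i. Lin F (Ss ! i))"
        by blast
      from PiE_mem[OF this, of i] that show ?thesis by simp
    qed
    have pplus: "prjA F S S' \<phi> = plus_aff F S' (prjA F S S' \<zeta>) (prjL F S S' v)" if "S' \<in> set Ss" for S'
    proof -
      have "\<forall>\<eta>\<in>Aff F S. \<forall>\<phi>\<in>Lin F S.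
          prjA F S S' (plus_aff F S \<eta> \<phi>) = plus_aff F S' (prjA F S S' \<eta>) (prjL F S S' \<phi>)"
        using c3 that by blast
      then show ?thesis using \<zeta> v by auto
    qed
    have inH: "Ss ! i \<in> Hyps X" "Ss ! i \<in> set Ss" if "i < length Ss" for i
      using Ss that by auto
    have p\<phi>: "prjA F S (Ss ! i) \<phi> \<in> Aff F (Ss ! i)"
      and d: "diffA F (Ss ! i) (prjA F S (Ss ! i) \<phi>) (prjA F S (Ss ! i) \<zeta>) = prjL F S (Ss ! i) v"
      if "i < length Ss" for i
      using plus_in[OF inH(1)[OF that] p\<zeta> pv[OF that]] diffA_eq[OF inH(1)[OF that] p\<zeta> pv[OF that]]
        pplus[OF inH(2)[OF that]] inH(2)[OF that] by simp_all
    have theta: "theta F S \<eta> v =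
        (\<Sum>i<length Ss. theta F (Ss ! i) (prjA F S (Ss ! i) \<eta>) (prjL F S (Ss ! i) v))"
      if "\<eta> \<in> Aff F S" for \<eta>
      using c3 that v(1) by blast
    have "herm F S v v =
        (\<Sum>i<length Ss. herm F (Ss ! i) (prjL F S (Ss ! i) v) (prjL F S (Ss ! i) v))"
      using c3 v(1) by blast
    then have g: "gform F S v v =
        (\<Sum>i<length Ss. gform F (Ss ! i) (prjL F S (Ss ! i) v) (prjL F S (Ss ! i) v))"
      by (simp add: gform_def)
    show ?thesis
      using \<phi> p\<phi> d
      by (simp add: coherent_def tensor_def theta[OF \<zeta>] theta[OF \<phi>] g sum.distrib sum_subtractf
          sum_distrib_left sum_divide_distrib flip: v_def exp_sum)
  qed
qed

end

section \<open>Change of the action\<close>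

text \<open>Only the action changes. Equations between whole functions can be lifted layer by layer,
  from fields to derived notions, axioms and states.\<close>

lemma selectors_action_update:
  fixes F :: "('p, 'a, 'l::real_vector, 'ar, 'lr::real_vector) field_theory"
  shows "Aff (F\<lparr>action := a\<rparr>) = Aff F" "Lin (F\<lparr>action := a\<rparr>) = Lin F"
    "plus_aff (F\<lparr>action := a\<rparr>) = plus_aff F" "cscale (F\<lparr>action := a\<rparr>) = cscale F"
    "herm (F\<lparr>action := a\<rparr>) = herm F" "theta (F\<lparr>action := a\<rparr>) = theta F"
    "brak (F\<lparr>action := a\<rparr>) = brak F" "revA (F\<lparr>action := a\<rparr>) = revA F"
    "revL (F\<lparr>action := a\<rparr>) = revL F" "cpyA (F\<lparr>action := a\<rparr>) = cpyA F"
    "cpyL (F\<lparr>action := a\<rparr>) = cpyL F" "prjA (F\<lparr>action := a\<rparr>) = prjA F"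
    "prjL (F\<lparr>action := a\<rparr>) = prjL F" "AffR (F\<lparr>action := a\<rparr>) = AffR F"
    "LinR (F\<lparr>action := a\<rparr>) = LinR F" "plus_affR (F\<lparr>action := a\<rparr>) = plus_affR F"
    "bdA (F\<lparr>action := a\<rparr>) = bdA F" "bdL (F\<lparr>action := a\<rparr>) = bdL F"
    "prjAR (F\<lparr>action := a\<rparr>) = prjAR F" "prjLR (F\<lparr>action := a\<rparr>) = prjLR F"
    "gluA (F\<lparr>action := a\<rparr>) = gluA F" "gluL (F\<lparr>action := a\<rparr>) = gluL F"
    "action (F\<lparr>action := a\<rparr>) = a"
  by simp_all

lemma derived_action_update:
  fixes F :: "('p, 'a, 'l::real_vector, 'ar, 'lr::real_vector) field_theory"
  shows "gform (F\<lparr>action := a\<rparr>) = gform F" "omega (F\<lparr>action := a\<rparr>) = omega F"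
    "diffA (F\<lparr>action := a\<rparr>) = diffA F" "diffAR (F\<lparr>action := a\<rparr>) = diffAR F"
    "Aff_tilde (F\<lparr>action := a\<rparr>) = Aff_tilde F" "Lin_tilde (F\<lparr>action := a\<rparr>) = Lin_tilde F"
    "coincideA (F\<lparr>action := a\<rparr>) = coincideA F" "coincideL (F\<lparr>action := a\<rparr>) = coincideL F"
    "hat_herm (F\<lparr>action := a\<rparr>) = hat_herm F" "copy_state (F\<lparr>action := a\<rparr>) = copy_state F"
    "tensor (F\<lparr>action := a\<rparr>) = tensor F" "iota (F\<lparr>action := a\<rparr>) = iota F"
  by (simp_all only: fun_eq_iff gform_def omega_def diffA_def diffAR_def Aff_tilde_def Lin_tilde_def
      coincideA_def coincideL_def hat_herm_def copy_state_def tensor_def iota_def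
      selectors_action_update simp_thms)

lemma normL_action_update: "normL (F\<lparr>action := a\<rparr>) = normL F"
  by (simp only: fun_eq_iff normL_def derived_action_update simp_thms)

lemma topologies_action_update:
  "topL (F\<lparr>action := a\<rparr>) = topL F" "topA (F\<lparr>action := a\<rparr>) = topA F"
  by (simp_all only: fun_eq_iff topL_def topA_def normL_action_update derived_action_update
      selectors_action_update simp_thms)

lemma axioms_action_update:
  "axiom_C1 (F\<lparr>action := a\<rparr>) X = axiom_C1 F X"
  "axiom_C2 (F\<lparr>action := a\<rparr>) d X = axiom_C2 F d X"
  "axiom_C3 (F\<lparr>action := a\<rparr>) d X = axiom_C3 F d X"
  "copies_identified (F\<lparr>action := a\<rparr>) X = copies_identified F X"
  "axiom_C4 (F\<lparr>action := a\<rparr>) X = axiom_C4 F X"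
  by (simp_all only: axiom_C1_def complex_separable_Hilbert_def axiom_C2_def axiom_C3_def
      copies_identified_def axiom_C4_def
      topologies_action_update normL_action_update derived_action_update selectors_action_update)

lemma states_action_update:
  "coherent (F\<lparr>action := a\<rparr>) = coherent F" "chi (F\<lparr>action := a\<rparr>) = chi F"
  "holomorphic_cylinder (F\<lparr>action := a\<rparr>) = holomorphic_cylinder F"
  "gaussian_measures (F\<lparr>action := a\<rparr>) = gaussian_measures F"
  by (simp_all only: fun_eq_iff coherent_def chi_def alpha_def holomorphic_cylinder_def
      gaussian_measures_def derived_action_update selectors_action_update simp_thms)

lemma state_space_action_update: "state_space (F\<lparr>action := a\<rparr>) = state_space F"
  by (simp only: fun_eq_iff state_space_def square_integrable_holomorphic_def
      states_action_update derived_action_update selectors_action_update simp_thms)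

lemma gluing_state_action_update: "gluing_state (F\<lparr>action := a\<rparr>) = gluing_state F"
  by (simp only: fun_eq_iff gluing_state_def Let_def
      states_action_update derived_action_update selectors_action_update simp_thms)

text \<open>The constants are arbitrary: only disjoint unions and gluings will restrict them, and
  the vacuum action is one instance.\<close>

abbreviation shift_action ::
    "('p, 'a, 'l::real_vector, 'ar, 'lr::real_vector) field_theory \<Rightarrow> ('p region \<Rightarrow> real) \<Rightarrow>
     ('p, 'a, 'l, 'ar, 'lr) field_theory" where
  "shift_action F c \<equiv> F\<lparr>action := \<lambda>M \<zeta>. action F M \<zeta> - c M\<rparr>"

text \<open>Here the action is only compared with itself on the same region, so the constant
  cancels.\<close>

lemma axiom_C5_shift_action: "axiom_C5 (shift_action F c) X = axiom_C5 F X"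
proof -
  have "a - s = b - s - x - y \<longleftrightarrow> a = b - x - y" "a - s = b - s \<longleftrightarrow> a = b" for a b s x y :: real
    by auto
  then show ?thesis
    by (simp only: axiom_C5_def topologies_action_update derived_action_update selectors_action_update)
qed

text \<open>The constants must be additive because the action is; all other clauses are free of the
  action.\<close>

lemma axiom_C6_shift_action:
  assumes C6: "axiom_C6 F d X"
    and c: "\<And>M M1 M2. \<lbrakk>M \<in> Regs X; M1 \<in> Regs X; M2 \<in> Regs X; disj_union_region d M M1 M2\<rbrakk> \<Longrightarrow>
      c M = c M1 + c M2"
  shows "axiom_C6 (shift_action F c) d X"
  unfolding axiom_C6_def selectors_action_update
proof (intro ballI impI, goal_cases)
  case (1 M M1 M2)
  note c6 = C6[unfolded axiom_C6_def, THEN bspec, OF 1(1), THEN bspec, OF 1(2), THEN bspec, OF 1(3),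
      THEN mp, OF 1(4)]
  have "\<forall>\<eta>\<in>AffR F M. action F M \<eta> = action F M1 (prjAR F M M1 \<eta>) + action F M2 (prjAR F M M2 \<eta>)"
    using c6 by blast
  then have "\<forall>\<eta>\<in>AffR F M. action F M \<eta> - c M =
      action F M1 (prjAR F M M1 \<eta>) - c M1 + (action F M2 (prjAR F M M2 \<eta>) - c M2)"
    using c[OF 1] by simp
  with c6 show ?case by (elim conjE) (intro conjI; assumption)
qed

lemma axiom_C7_shift_action:
  assumes C7: "axiom_C7 F d X" and c: "\<And>gl. gl \<in> Gluings X \<Longrightarrow> c (gM1 gl) = c (gM gl)"
  shows "axiom_C7 (shift_action F c) d X"
  unfolding axiom_C7_def Let_def derived_action_update selectors_action_update
proof (intro ballI, goal_cases)
  case (1 gl)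
  have cancel: "a - c (gM1 gl) = b - c (gM gl) \<longleftrightarrow> a = b" for a b
    using c[OF 1] by simp
  show ?case unfolding cancel by (fact bspec[OF C7[unfolded axiom_C7_def Let_def] 1])
qed

text \<open>The shift changes the prefactor by the same nonzero phase at every base point, so the
  phase can be moved over to the value.\<close>

lemma has_amplitude_shift_action:
  "has_amplitude (shift_action F c) \<nu> \<nu>t M \<psi> z \<longleftrightarrow>
   has_amplitude F \<nu> \<nu>t M \<psi> (exp (\<i> * of_real (c M)) * z)"
proof -
  have "exp (\<i> * of_real (a - c M)) = exp (\<i> * of_real a) / exp (\<i> * of_real (c M))" for a
    by (simp add: right_diff_distrib exp_diff)
  moreover have "z = A / e * I \<longleftrightarrow> e * z = A * I" if "e \<noteq> 0" for A e I :: complex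
    using that by (auto simp: field_simps)
  ultimately have "z = exp (\<i> * of_real (a - c M)) * I \<longleftrightarrow>
      exp (\<i> * of_real (c M)) * z = exp (\<i> * of_real a) * I" for a I
    by simp
  then show ?thesis
    by (simp only: has_amplitude_def state_space_action_update states_action_update
        derived_action_update selectors_action_update)
qed

section \<open>Amplitudes and integrability under a shift\<close>

context gaussian_theory
begin

lemma amplitude_shift_action:
  assumes M: "M \<in> Regs X"
  shows "amplitude_defined (shift_action F c) \<nu> \<nu>t M \<psi> = amplitude_defined F \<nu> \<nu>t M \<psi>"
    and "amplitude_defined F \<nu> \<nu>t M \<psi> \<Longrightarrow>
      amplitude (shift_action F c) \<nu> \<nu>t M \<psi> = exp (- \<i> * of_real (c M)) * amplitude F \<nu> \<nu>t M \<psi>"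
proof -
  let ?e = "exp (- \<i> * of_real (c M))"
  have e: "exp (\<i> * of_real (c M)) * (?e * z) = z" for z
    by (simp add: mult.assoc[symmetric] flip: exp_add)
  show "amplitude_defined (shift_action F c) \<nu> \<nu>t M \<psi> = amplitude_defined F \<nu> \<nu>t M \<psi>"
    unfolding amplitude_defined_def has_amplitude_shift_action by (metis e)
  assume "amplitude_defined F \<nu> \<nu>t M \<psi>"
  then obtain z where z: "has_amplitude F \<nu> \<nu>t M \<psi> z" by (auto simp: amplitude_defined_def)
  have "amplitude (shift_action F c) \<nu> \<nu>t M \<psi> = ?e * z"
    unfolding amplitude_def has_amplitude_shift_action
  proof (rule the_equality)
    fix w assume "has_amplitude F \<nu> \<nu>t M \<psi> (exp (\<i> * of_real (c M)) * w)"
    then have "z = exp (\<i> * of_real (c M)) * w" using has_amplitude_unique[OF M z] by blast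
    then show "w = ?e * z" by (simp add: mult.assoc[symmetric] flip: exp_add)
  qed (use z in \<open>simp only: e\<close>)
  then show "amplitude (shift_action F c) \<nu> \<nu>t M \<psi> = ?e * amplitude F \<nu> \<nu>t M \<psi>"
    using amplitude_eq[OF M z] by simp
qed

text \<open>The shift multiplies the function of \<xi> by a phase \<open>e\<close> independent of
  \<xi>; extensions and integrals scale with it, and a nonzero integral stays nonzero. The phase
  relation is available only where amplitudes are defined, so the equivalence is proved under that
  clause of the condition.\<close>

lemma integrability_condition_shift_action:
  assumes gl: "gl \<in> Gluings X"
  shows "integrability_condition (shift_action F c) \<nu> \<nu>t d gl \<longleftrightarrow>
    integrability_condition F \<nu> \<nu>t d gl"
proof -
  define e where "e = exp (- \<i> * complex_of_real (c (gM gl)))"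
  have e0: "e \<noteq> 0" by (simp add: e_def)
  have M: "gM gl \<in> Regs X" using gluing_in[OF gl] by blast
  have S: "gS gl \<in> Hyps X" using gluing_in[OF gl] copy_in by blast
  let ?V = "Lin F (gS gl)" and ?g = "gform F (gS gl)" and ?\<nu> = "\<nu> (gS gl)"
  let ?\<Phi> = "\<lambda>F \<eta> \<xi>. amplitude F \<nu> \<nu>t (gM gl) (gluing_state F d gl \<eta> \<xi>) *
    complex_of_real (exp (?g \<xi> \<xi> / 2))"
  have "(\<exists>G. extends_to_hat ?V ?g ?\<nu> (?\<Phi> (shift_action F c) \<eta>) G \<and> integrable ?\<nu> G \<and>
        (\<integral>x. G x \<partial>?\<nu>) \<noteq> 0) \<longleftrightarrow>
      (\<exists>G. extends_to_hat ?V ?g ?\<nu> (?\<Phi> F \<eta>) G \<and> integrable ?\<nu> G \<and> (\<integral>x. G x \<partial>?\<nu>) \<noteq> 0)"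
      (is "(\<exists>G. ?P G) \<longleftrightarrow> (\<exists>G. ?Q G)")
    if "\<forall>\<xi>\<in>?V. amplitude_defined F \<nu> \<nu>t (gM gl) (gluing_state F d gl \<eta> \<xi>)" for \<eta>
  proof -
    have ext: "extends_to_hat ?V ?g ?\<nu> (?\<Phi> (shift_action F c) \<eta>) G \<longleftrightarrow>
        extends_to_hat ?V ?g ?\<nu> (?\<Phi> F \<eta>) (\<lambda>x. G x / e)" for G
    proof -
      have "?\<Phi> (shift_action F c) \<eta> \<xi> = e * ?\<Phi> F \<eta> \<xi>" if "\<xi> \<in> ?V" for \<xi>
        using amplitude_shift_action(2)[OF M] \<open>\<forall>\<xi>\<in>?V. _ \<xi>\<close> that
        by (simp add: gluing_state_action_update e_def)
      then show ?thesis
        by (simp only: extends_to_hat_cong[OF inner_Lin[OF S], of _ "\<lambda>\<xi>. e * ?\<Phi> F \<eta> \<xi>"]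
            extends_to_hat_cmult_iff[OF e0])
    qed
    have "?P G \<Longrightarrow> ?Q (\<lambda>x. G x / e)" "?Q G \<Longrightarrow> ?P (\<lambda>x. G x * e)" for G
      using e0 by (simp_all add: ext)
    then show ?thesis by meson
  qed
  then show ?thesis
    unfolding integrability_condition_def gluing_state_action_update derived_action_update
      selectors_action_update amplitude_shift_action(1)[OF M]
    by (simp cong: conj_cong)
qed

end

section \<open>Vacuum states of a global solution\<close>

lemma exp_i_eq_1_iff: "exp (\<i> * complex_of_real s) = 1 \<longleftrightarrow> (\<exists>k::int. s = 2 * pi * of_int k)"
  by (auto simp: exp_eq_1 mult_ac)

text \<open>This gives "generically" a precise meaning: the exceptional values are the multiples of
  \<open>2 * pi\<close>, so they form a countable and hence null set, closed as the solution set of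
  a continuous equation, and a countable set contains no ball.\<close>

lemma exp_i_eq_1_negligible:
  fixes Z :: "real set"
  defines "Z \<equiv> {s. exp (\<i> * complex_of_real s) = 1}"
  shows "Z \<in> null_sets lborel" and "closed Z" and "interior Z = {}"
proof -
  have "Z = range (\<lambda>k::int. 2 * pi * of_int k)"
    by (auto simp: Z_def exp_i_eq_1_iff)
  then have "countable Z" by simp
  then show "Z \<in> null_sets lborel" by (rule countable_imp_null_set_lborel)
  show "closed Z" unfolding Z_def by (intro closed_Collect_eq continuous_intros)
  show "interior Z = {}"
    using \<open>countable Z\<close> by (meson countable_subset equals0I mem_interior uncountable_ball)
qed

locale vacuum = gaussian_theory F d X \<nu> \<nu>t
  for F :: "('p, 'a, 'l::real_vector, 'ar, 'lr::real_vector) field_theory"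
    and d :: nat and X :: "'p spacetime"
    and \<nu> :: "'p hyp \<Rightarrow> (('l \<Rightarrow> real) \<Rightarrow> real) measure"
    and \<nu>t :: "'p region \<Rightarrow> (('l \<Rightarrow> real) \<Rightarrow> real) measure" +
  fixes \<phi> :: "'p hyp \<Rightarrow> 'a"
  assumes solution: "global_solution F d X \<phi>"
begin

lemma sol_in: "S \<in> Hyps X \<Longrightarrow> \<phi> S \<in> Aff F S"
  and sol_rev: "S \<in> Hyps X \<Longrightarrow> \<phi> (rev_hyp d S) = revA F S (\<phi> S)"
  and sol_prj: "\<lbrakk>S \<in> Hyps X; set Ss \<subseteq> Hyps X; disj_union_hyp d S Ss; S' \<in> set Ss\<rbrakk> \<Longrightarrow>
    prjA F S S' (\<phi> S) = \<phi> S'"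
  and sol_region: "M \<in> Regs X \<Longrightarrow> \<phi> (rbd M) \<in> Aff_tilde F M"
  and sol_copy: "(S, S', f) \<in> Copies X \<Longrightarrow> \<phi> S' = cpyA F (S, S', f) (\<phi> S)"
  using solution unfolding global_solution_def by blast+

lemma vacuum_V1: "vacuum_V1 F \<nu> X \<phi> (\<lambda>S. coherent F S (\<phi> S))"
  unfolding vacuum_V1_def
  by (simp add: coherent_in_state_space gaussian_Lin sol_in)

lemma vacuum_V2: "vacuum_V2 F d X (\<lambda>S. coherent F S (\<phi> S))"
  unfolding vacuum_V2_def
proof
  fix S assume S: "S \<in> Hyps X"
  show "coherent F (rev_hyp d S) (\<phi> (rev_hyp d S)) = iota F d S (coherent F S (\<phi> S))"
    using coherent_rev[OF S sol_in[OF S]] sol_in[OF rev_in[OF S]] by (simp add: sol_rev[OF S])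
qed

lemma vacuum_V3: "vacuum_V3 F d X (\<lambda>S. coherent F S (\<phi> S))"
  unfolding vacuum_V3_def
proof (intro ballI allI impI, elim conjE)
  fix S Ss assume S: "S \<in> Hyps X" and Ss: "set Ss \<subseteq> Hyps X" and U: "disj_union_hyp d S Ss"
  have p: "prjA F S S' (\<phi> S) = \<phi> S'" if "S' \<in> set Ss" for S'
    using sol_prj[OF S Ss U that] .
  have "coherent F S (\<phi> S) = tensor F S Ss (map (\<lambda>S'. coherent F S' (prjA F S S' (\<phi> S))) Ss)"
    using p Ss by (intro coherent_tensor[OF S Ss U]) (auto intro: sol_in S)
  also have "map (\<lambda>S'. coherent F S' (prjA F S S' (\<phi> S))) Ss = map (\<lambda>S. coherent F S (\<phi> S)) Ss"
    using p by simp
  finally show "coherent F S (\<phi> S) = tensor F S Ss (map (\<lambda>S. coherent F S (\<phi> S)) Ss)" .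
qed

lemma vacuum_amplitude:
  assumes "M \<in> Regs X"
  shows "amplitude_defined F \<nu> \<nu>t M (coherent F (rbd M) (\<phi> (rbd M)))"
    and "amplitude F \<nu> \<nu>t M (coherent F (rbd M) (\<phi> (rbd M))) =
      exp (\<i> * of_real (action_tilde F M (\<phi> (rbd M))))"
  using amplitude_coherent[OF assms sol_region[OF assms]] by simp_all

section \<open>Additivity and gluing invariance of the vacuum action\<close>

lemma sol_action:
  assumes M: "M \<in> Regs X" and \<zeta>: "\<zeta> \<in> AffR F M" "bdA F M \<zeta> = \<phi> (rbd M)"
  shows "action_tilde F M (\<phi> (rbd M)) = action F M \<zeta>"
  using action_tilde_eq[OF M \<zeta>(1)] \<zeta>(2) by simp

text \<open>A representative of the vacuum on \<open>M\<close> projects to representatives on the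
  parts, because the global solution is compatible with restriction to the boundaries of the
  parts.\<close>

lemma sol_action_disj_union:
  assumes M: "M \<in> Regs X" "M1 \<in> Regs X" "M2 \<in> Regs X" and U: "disj_union_region d M M1 M2"
  shows "action_tilde F M (\<phi> (rbd M)) = action_tilde F M1 (\<phi> (rbd M1)) + action_tilde F M2 (\<phi> (rbd M2))"
proof -
  note c6 = C6[unfolded axiom_C6_def, THEN bspec, OF M(1), THEN bspec, OF M(2), THEN bspec, OF M(3),
      THEN mp, OF U]
  obtain \<zeta> where \<zeta>: "\<zeta> \<in> AffR F M" "bdA F M \<zeta> = \<phi> (rbd M)"
    using sol_region[OF M(1)] by (auto simp: Aff_tilde_def)
  have bij: "bij_betw (\<lambda>\<eta>. (prjAR F M M1 \<eta>, prjAR F M M2 \<eta>)) (AffR F M) (AffR F M1 \<times> AffR F M2)"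
    using c6 by blast
  have act: "action F M \<zeta> = action F M1 (prjAR F M M1 \<zeta>) + action F M2 (prjAR F M M2 \<zeta>)"
    using c6 \<zeta>(1) by blast
  have part: "action_tilde F M' (\<phi> (rbd M')) = action F M' (prjAR F M M' \<zeta>)" if M': "M' \<in> {M1, M2}" for M'
  proof (rule sol_action)
    have "disj_union_hyp d (rbd M) [rbd M1, rbd M2]" using U by (simp add: disj_union_region_def)
    then have "prjA F (rbd M) (rbd M') (\<phi> (rbd M)) = \<phi> (rbd M')"
      using M M' rbd_in by (intro sol_prj) auto
    moreover have "prjA F (rbd M) (rbd M') (bdA F M \<zeta>) = bdA F M' (prjAR F M M' \<zeta>)"
      using c6 M' \<zeta>(1) by blast
    ultimately show "bdA F M' (prjAR F M M' \<zeta>) = \<phi> (rbd M')" using \<zeta>(2) by simp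
    show "prjAR F M M' \<zeta> \<in> AffR F M'" using bij_betwE[OF bij] \<zeta>(1) M' by auto
  qed (use M M' in auto)
  show ?thesis using sol_action[OF M(1) \<zeta>] act part by simp
qed

text \<open>A representative on the unglued region satisfies the coincidence condition and hence
  comes from the glued region by \<open>axiom_C7\<close>; its boundary value there is again the
  vacuum.\<close>

lemma sol_action_gluing:
  assumes gl: "gl \<in> Gluings X"
  shows "action_tilde F (gM1 gl) (\<phi> (rbd (gM1 gl))) = action_tilde F (gM gl) (\<phi> (rbd (gM gl)))"
proof -
  let ?M = "gM gl" and ?M1 = "gM1 gl" and ?R = "rev_hyp d (gS' gl)"
  note c7 = bspec[OF C7[unfolded axiom_C7_def Let_def] gl]
  have M: "?M \<in> Regs X" "?M1 \<in> Regs X" and copy: "ghcopy gl \<in> Copies X" and g: "gluing d gl"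
    using gluing_in[OF gl] by auto
  have S: "gS gl \<in> Hyps X" "gS' gl \<in> Hyps X" using copy_in[OF copy] by auto
  have U: "disj_union_hyp d (rbd ?M) [rbd ?M1, gS gl, ?R]" using g by (simp add: gluing_def)
  have prj: "prjA F (rbd ?M) S' (\<phi> (rbd ?M)) = \<phi> S'" if "S' \<in> {rbd ?M1, gS gl, ?R}" for S'
    using that M S rbd_in rev_in by (intro sol_prj[OF _ _ U]) auto
  obtain \<zeta> where \<zeta>: "\<zeta> \<in> AffR F ?M" "bdA F ?M \<zeta> = \<phi> (rbd ?M)"
    using sol_region[OF M(1)] by (auto simp: Aff_tilde_def)
  \<comment> \<open>Through \<open>gS\<close> the copy map sends the solution on \<open>gS\<close>
    to that on \<open>gS'\<close>; on the other side two reversals cancel and leave the same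
    element.\<close>
  have "coincideA F d gl \<zeta>"
    using sol_copy[OF copy] revA_revA[OF S(2) sol_in[OF S(2)]]
    by (simp add: coincideA_def \<zeta>(2) prj sol_rev[OF S(2)])
  then have "\<zeta> \<in> gluA F gl ` AffR F ?M1" using c7 \<zeta>(1) by blast
  then obtain \<eta> where \<eta>: "\<eta> \<in> AffR F ?M1" "\<zeta> = gluA F gl \<eta>" by blast
  have "action F ?M1 \<eta> = action F ?M (gluA F gl \<eta>)"
    and "bdA F ?M1 \<eta> = prjA F (rbd ?M) (rbd ?M1) (bdA F ?M (gluA F gl \<eta>))"
    using c7 \<eta>(1) by blast+
  then have "action_tilde F ?M1 (\<phi> (rbd ?M1)) = action F ?M \<zeta>"
    using sol_action[OF M(2) \<eta>(1)] \<zeta>(2) \<eta>(2) by (simp add: prj)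
  then show ?thesis using sol_action[OF M(1) \<zeta>] by simp
qed

section \<open>The theory with vacuum action subtracted\<close>

lemma shifted_theory_eq:
  "shifted_theory F \<phi> = shift_action F (\<lambda>M. action_tilde F M (\<phi> (rbd M)))"
  by (simp add: shifted_theory_def)

lemma shifted_field_theory: "affine_field_theory (shifted_theory F \<phi>) d X"
  unfolding affine_field_theory_def shifted_theory_eq axioms_action_update axiom_C5_shift_action
  using C1 C2 C3 copies C4 C5
    axiom_C6_shift_action[OF C6 sol_action_disj_union] axiom_C7_shift_action[OF C7 sol_action_gluing]
  by (intro conjI)

text \<open>Global solutions and Gaussian measures do not refer to the action, so all results on the
  vacuum apply to the shifted theory as well.\<close>

lemma shifted_vacuum: "vacuum (shifted_theory F \<phi>) d X \<nu> \<nu>t \<phi>"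
proof
  show "spacetime_system d X" by (rule system)
  show "affine_field_theory (shifted_theory F \<phi>) d X" by (rule shifted_field_theory)
  show "gaussian_measures (shifted_theory F \<phi>) \<nu> \<nu>t X"
    unfolding shifted_theory_eq states_action_update by (rule gaussian)
  show "global_solution (shifted_theory F \<phi>) d X \<phi>"
    using solution unfolding shifted_theory_eq global_solution_def
    by (simp only: derived_action_update selectors_action_update)
qed

text \<open>The value is again a definite description, so it is read off at a representative of the
  vacuum, where action and subtracted constant agree.\<close>

lemma shifted_action_tilde:
  assumes M: "M \<in> Regs X"
  shows "action_tilde (shifted_theory F \<phi>) M (\<phi> (rbd M)) = 0"
proof -
  interpret shifted: vacuum "shifted_theory F \<phi>" d X \<nu> \<nu>t \<phi> by (rule shifted_vacuum)
  obtain \<zeta> where \<zeta>: "\<zeta> \<in> AffR F M" "bdA F M \<zeta> = \<phi> (rbd M)"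
    using sol_region[OF M] by (auto simp: Aff_tilde_def)
  then have "action_tilde (shifted_theory F \<phi>) M (\<phi> (rbd M)) = action (shifted_theory F \<phi>) M \<zeta>"
    by (intro shifted.sol_action[OF M]) (simp_all only: shifted_theory_eq selectors_action_update)
  also have "\<dots> = 0"
    by (simp add: shifted_theory_eq sol_action[OF M \<zeta>])
  finally show ?thesis .
qed

end

theorem mainTheorem4:
  fixes d :: nat
    and X :: "'p spacetime"
    and B :: "'b topology"
    and pos :: "'p \<Rightarrow> 'b"
    and F F' :: "('p, 'a, 'l::real_vector, 'ar, 'lr::real_vector) field_theory"
    and \<nu> :: "'p hyp \<Rightarrow> (('l \<Rightarrow> real) \<Rightarrow> real) measure"
    and \<nu>t :: "'p region \<Rightarrow> (('l \<Rightarrow> real) \<Rightarrow> real) measure"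
    and \<phi> :: "'p hyp \<Rightarrow> 'a"
    and \<psi>0 :: "'p hyp \<Rightarrow> 'a \<Rightarrow> complex"
  assumes "spacetime_system d X"
    and "submanifolds_of d B pos X"
    and "affine_field_theory F d X"
    and "gaussian_measures F \<nu> \<nu>t X"
    and "global_solution F d X \<phi>"
    and "\<psi>0 = (\<lambda>S. coherent F S (\<phi> S))"
    and "F' = shifted_theory F \<phi>"
  shows "vacuum_V1 F \<nu> X \<phi> \<psi>0 \<and>
    vacuum_V2 F d X \<psi>0 \<and>
    vacuum_V3 F d X \<psi>0 \<and>
    (\<forall>M\<in>Regs X. amplitude_defined F \<nu> \<nu>t M (\<psi>0 (rbd M)) \<and>
         amplitude F \<nu> \<nu>t M (\<psi>0 (rbd M)) = exp (\<i> * of_real (action_tilde F M (\<phi> (rbd M))))) \<and>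
    (vacuum_V5 F \<nu> \<nu>t X \<psi>0 \<longleftrightarrow>
         (\<forall>M\<in>Regs X. \<exists>k::int. action_tilde F M (\<phi> (rbd M)) = 2 * pi * of_int k)) \<and>
    ({s::real. exp (\<i> * of_real s) = 1} \<in> null_sets lborel \<and>
         closed {s::real. exp (\<i> * of_real s) = 1} \<and>
         interior {s::real. exp (\<i> * of_real s) = 1} = {}) \<and>
    vacuum_V5' F \<nu> \<nu>t X \<psi>0 \<and>
    affine_field_theory F' d X \<and>
    (\<forall>gl\<in>Gluings X. integrability_condition F' \<nu> \<nu>t d gl \<longleftrightarrow>
         integrability_condition F \<nu> \<nu>t d gl) \<and>
    vacuum_V1 F' \<nu> X \<phi> \<psi>0 \<and>
    vacuum_V2 F' d X \<psi>0 \<and>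
    vacuum_V3 F' d X \<psi>0 \<and>
    vacuum_V5 F' \<nu> \<nu>t X \<psi>0"
proof -
  note \<psi>0 = assms(6) and F' = assms(7)
  interpret vacuum F d X \<nu> \<nu>t \<phi> by standard (use assms in auto)
  interpret shifted: vacuum F' d X \<nu> \<nu>t \<phi> unfolding F' by (rule shifted_vacuum)
  \<comment> \<open>Coherent states do not depend on the action, so the same functions are the
    vacuum states of the shifted theory.\<close>
  have \<psi>0': "\<psi>0 = (\<lambda>S. coherent F' S (\<phi> S))"
    by (simp only: \<psi>0 F' shifted_theory_eq states_action_update)
  have amp: "amplitude_defined F \<nu> \<nu>t M (\<psi>0 (rbd M)) \<and>
      amplitude F \<nu> \<nu>t M (\<psi>0 (rbd M)) = exp (\<i> * of_real (action_tilde F M (\<phi> (rbd M))))"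
    if "M \<in> Regs X" for M
    using vacuum_amplitude[OF that] by (simp add: \<psi>0)
  have "vacuum_V5 F \<nu> \<nu>t X \<psi>0 \<longleftrightarrow>
      (\<forall>M\<in>Regs X. \<exists>k::int. action_tilde F M (\<phi> (rbd M)) = 2 * pi * of_int k)"
    by (simp add: vacuum_V5_def amp exp_i_eq_1_iff)
  moreover have "vacuum_V5' F \<nu> \<nu>t X \<psi>0"
    by (simp add: vacuum_V5'_def amp)
  moreover have "\<forall>gl\<in>Gluings X. integrability_condition F' \<nu> \<nu>t d gl \<longleftrightarrow>
      integrability_condition F \<nu> \<nu>t d gl"
    unfolding F' shifted_theory_eq by (intro ballI integrability_condition_shift_action)
  moreover have "vacuum_V5 F' \<nu> \<nu>t X \<psi>0"
    using shifted.vacuum_amplitude shifted_action_tilde by (simp add: vacuum_V5_def \<psi>0' F')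
  ultimately show ?thesis
    using amp exp_i_eq_1_negligible shifted.field
      vacuum_V1 vacuum_V2 vacuum_V3 shifted.vacuum_V1 shifted.vacuum_V2 shifted.vacuum_V3
    by (simp only: flip: \<psi>0 \<psi>0') blast
qed

end
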